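(* Let $s\geq 2$, $t\geq 1$ and $n\geq 2$ be integers, and let $p:F(\mathbb{R}^2,s+t)\to F(\mathbb{R}^2,s)$ be the Fadell–Neuwirth fibration $p(x_1,\dots,x_{s+t})=(x_1,\dots,x_s)$. Then $$\mathrm{TC}_n[p:F(\mathbb{R}^{2},s+t)\to F(\mathbb{R}^{2},s)]=nt+s-2.$$
   Context: $F(\mathbb{R}^2,k)=\{(x_1,\dots,x_k)\in(\mathbb{R}^2)^k \mid x_i\neq x_j\text{ for } i\neq j\}$ is the ordered configuration space of $k$ points in the plane. For a fibration $p:E\to B$, let $E^n_B=\{(e_1,\dots,e_n)\in E^n\mid p(e_1)=\dots=p(e_n)\}$, and let $E^I_B$ be the subspace of the path space $E^I$ (compact-open topology, $I=[0,1]$) consisting of the paths $\gamma$ with $p\circ\gamma$ constant. Let $\Pi_n:E^I_B\to E^n_B$ be the fibration $$\Pi_n(\gamma)=\Big(\gamma(0),\gamma\big(\tfrac{1}{n-1}\big),\dots,\gamma\big(\tfrac{n-2}{n-1}\big),\gamma(1)\Big).$$ The sequential parametrized topological complexity $\mathrm{TC}_n[p:E\to B]$ is the least integer $r\ge 0$ such that $E^n_B$ has an open cover $\{U_0,\dots,U_r\}$ with each $U_i$ admitting a continuous section of $\Pi_n$. *)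

theory Defs
  imports "HOL-Analysis.Analysis"
begin

text \<open>
  Points \<open>(x\<^sub>1, \<dots>, x\<^sub>k)\<close> of a power \<open>X\<^sup>k\<close> are extensional functions on the
  index set \<open>{..<k}\<close>, so coordinates are numbered from 0. All spaces are abstract topologies.
\<close>

definition configuration_space :: "'a topology \<Rightarrow> nat \<Rightarrow> (nat \<Rightarrow> 'a) topology" where
  "configuration_space X k =
     subtopology (product_topology (\<lambda>_. X) {..<k}) {x. \<forall>i<k. \<forall>j<k. i \<noteq> j \<longrightarrow> x i \<noteq> x j}"

definition fadell_neuwirth :: "nat \<Rightarrow> (nat \<Rightarrow> 'a) \<Rightarrow> (nat \<Rightarrow> 'a)" where
  "fadell_neuwirth s x = restrict x {..<s}"

text \<open>
  The function space \<open>Y\<^sup>X\<close> with the compact-open topology. A continuous map is represented by its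
  extensional representative, so that maps agreeing on \<open>topspace X\<close> are the same point. Taking
  \<open>K = {}\<close> shows that the generating family covers the whole function space.
\<close>

definition continuous_maps :: "'a topology \<Rightarrow> 'b topology \<Rightarrow> ('a \<Rightarrow> 'b) set" where
  "continuous_maps X Y = {f \<in> extensional (topspace X). continuous_map X Y f}"

definition compact_open_topology :: "'a topology \<Rightarrow> 'b topology \<Rightarrow> ('a \<Rightarrow> 'b) topology" where
  "compact_open_topology X Y =
     topology_generated_by
       {{f \<in> continuous_maps X Y. f ` K \<subseteq> U} | K U. compactin X K \<and> openin Y U}"

lemma topspace_compact_open_topology:
  "topspace (compact_open_topology X Y) = continuous_maps X Y"
proof -
  have "continuous_maps X Y \<in>
      {{f \<in> continuous_maps X Y. f ` K \<subseteq> U} | K U. compactin X K \<and> openin Y U}"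
    by (rule CollectI, rule exI[of _ "{}"], rule exI[of _ "{}"]) auto
  then show ?thesis
    unfolding compact_open_topology_def topology_generated_by_topspace by blast
qed

definition fibre_power :: "nat \<Rightarrow> 'e topology \<Rightarrow> ('e \<Rightarrow> 'b) \<Rightarrow> (nat \<Rightarrow> 'e) topology" where
  "fibre_power n E p =
     subtopology (product_topology (\<lambda>_. E) {..<n}) {e. \<forall>i<n. \<forall>j<n. p (e i) = p (e j)}"

definition fibre_path_space :: "'e topology \<Rightarrow> ('e \<Rightarrow> 'b) \<Rightarrow> (real \<Rightarrow> 'e) topology" where
  "fibre_path_space E p =
     subtopology (compact_open_topology (top_of_set {0..1}) E)
       {\<gamma>. \<forall>u\<in>{0..1}. \<forall>v\<in>{0..1}. p (\<gamma> u) = p (\<gamma> v)}"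

text \<open>The map \<open>\<Pi>\<^sub>n\<close>; meaningful for \<open>n \<ge> 2\<close>.\<close>

definition path_evaluation :: "nat \<Rightarrow> (real \<Rightarrow> 'e) \<Rightarrow> (nat \<Rightarrow> 'e)" where
  "path_evaluation n \<gamma> = (\<lambda>i\<in>{..<n}. \<gamma> (real i / real (n - 1)))"

definition has_local_section ::
    "'x topology \<Rightarrow> 'y topology \<Rightarrow> ('x \<Rightarrow> 'y) \<Rightarrow> 'y set \<Rightarrow> bool" where
  "has_local_section X Y f U \<longleftrightarrow>
     (\<exists>\<sigma>. continuous_map (subtopology Y U) X \<sigma> \<and> (\<forall>y \<in> topspace Y \<inter> U. f (\<sigma> y) = y))"

text \<open>
  Sequential parametrized topological complexity of \<open>p : E \<rightarrow> B\<close>. The base enters only through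
  equality of values of \<open>p\<close>, so its topology is not an argument. As \<open>Inf {} = \<infinity>\<close> on \<open>enat\<close>, the
  value is \<open>\<infinity>\<close> if no finite cover of the required kind exists.
\<close>

definition seq_param_TC :: "nat \<Rightarrow> 'e topology \<Rightarrow> ('e \<Rightarrow> 'b) \<Rightarrow> enat" where
  "seq_param_TC n E p =
     Inf {enat r | r. \<exists>U :: nat \<Rightarrow> (nat \<Rightarrow> 'e) set.
       (\<forall>i\<le>r. openin (fibre_power n E p) (U i) \<and>
          has_local_section (fibre_path_space E p) (fibre_power n E p) (path_evaluation n) (U i)) \<and>
       (\<Union>i\<le>r. U i) = topspace (fibre_power n E p)}"

lemma continuous_map_fadell_neuwirth:
  "continuous_map (configuration_space X (s + t)) (configuration_space X s) (fadell_neuwirth s)"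
proof -
  have "continuous_map (product_topology (\<lambda>_. X) {..<s+t}) (product_topology (\<lambda>_. X) {..<s})
          (fadell_neuwirth s)"
    unfolding continuous_map_componentwise fadell_neuwirth_def
    by (auto intro!: continuous_map_product_projection)
  then show ?thesis
    unfolding configuration_space_def
    by (auto simp: continuous_map_in_subtopology fadell_neuwirth_def
        intro!: continuous_map_from_subtopology)
qed

end

theory Submission
  imports Defs
begin

text \<open>
  Lower bound: a local section over \<open>U\<close> joins, for \<open>e \<in> U\<close>, the configurations \<open>e\<^sub>1\<close> and \<open>e\<^sub>j\<close>, so over \<open>U\<close>
  the direction from one point to another has the same winding in \<open>e\<^sub>1\<close> as in \<open>e\<^sub>j\<close>. Put \<open>x\<^sub>1 = 0\<close>, let
  \<open>x\<^sub>2, \<dots>, x\<^sub>s\<^sub>-\<^sub>1\<close> and the points of \<open>e\<^sub>1\<close> circle around it, fix \<open>x\<^sub>s\<close> far away and let the points of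
  \<open>e\<^sub>2, \<dots>, e\<^sub>n\<close> circle around \<open>x\<^sub>s\<close>. This is a torus with \<open>m = nt + s - 2\<close> angles; each angle is the
  difference of two such windings, hence it has a continuous real-valued branch on every \<open>U\<close>. But \<open>m\<close> open
  sets \<open>U\<^sub>k\<close> such that the \<open>k\<close>-th angle has a continuous branch \<open>h\<^sub>k\<close> on \<open>U\<^sub>k\<close> cannot cover the torus: with
  \<open>\<lambda>\<^sub>k \<ge> 0\<close> supported in \<open>U\<^sub>k\<close>, the functions \<open>\<lambda>\<^sub>k (\<theta>\<^sub>k - h\<^sub>k + \<pi>)\<close> on a large cube have a common zero by
  the Poincare-Miranda theorem, and there all \<open>\<lambda>\<^sub>k\<close> vanish.

  Upper bound: normalise \<open>x\<^sub>1 = 0\<close> and \<open>x\<^sub>2 = 1\<close>. The real parts of all points take between \<open>2\<close> and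
  \<open>nt + s\<close> values. Near the set where they take exactly \<open>k\<close> values, tilting the real axis by a small angle
  that depends continuously on the configuration makes the real parts within each \<open>e\<^sub>j\<close> distinct. Then the
  moving points can travel vertically to different heights above all \<open>x\<^sub>i\<close> and from there horizontally to a
  position that does not depend on \<open>j\<close>.
\<close>

subsection \<open>Coverings of the torus\<close>

lemma compact_PiE_UNIV:
  fixes S :: "'i \<Rightarrow> 'a::topological_space set"
  assumes "\<And>i. compact (S i)"
  shows "compact (PiE UNIV S)"
  using assms compactin_PiE[of "\<lambda>_. euclidean" UNIV S]
  by (simp add: euclidean_product_topology)

lemma tendsto_fun_iff:
  fixes X :: "'x \<Rightarrow> 'i \<Rightarrow> 'a::topological_space"
  shows "(X \<longlongrightarrow> l) F \<longleftrightarrow> (\<forall>i. ((\<lambda>n. X n i) \<longlongrightarrow> l i) F)"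
  using limitin_componentwise[of "\<lambda>_. euclidean :: 'a topology" UNIV X l F]
  by (simp add: euclidean_product_topology)

text \<open>On ever finer grids of the cube, Kuhn's combinatorial lemma finds cells in which every
  \<open>f k\<close> takes both signs; these cells shrink to a common zero. The cube lies in
  \<open>nat \<Rightarrow> real\<close>, with all coordinates from \<open>m\<close> on pinned to
  0.\<close>

lemma poincare_miranda:
  fixes f :: "nat \<Rightarrow> (nat \<Rightarrow> real) \<Rightarrow> real" and m :: nat
  defines "Q \<equiv> \<lambda>R. PiE UNIV (\<lambda>i. if i < m then {-R..R} else {0})"
  assumes "R > 0"
    and cont: "\<And>k. k < m \<Longrightarrow> continuous_on (Q R) (f k)"
    and low: "\<And>k x. k < m \<Longrightarrow> x \<in> Q R \<Longrightarrow> x k = - R \<Longrightarrow> f k x \<le> 0"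
    and high: "\<And>k x. k < m \<Longrightarrow> x \<in> Q R \<Longrightarrow> x k = R \<Longrightarrow> f k x \<ge> 0"
  shows "\<exists>x \<in> Q R. \<forall>k<m. f k x = 0"
proof -
  \<comment> \<open>Grid points have integer coordinates from 0 to \<open>Suc N\<close>;
    \<open>pt N\<close> carries them affinely onto a grid of the cube.\<close>
  define pt :: "nat \<Rightarrow> (nat \<Rightarrow> nat) \<Rightarrow> nat \<Rightarrow> real"
    where "pt N x = (\<lambda>i. if i < m then 2 * R * (real (x i) / real (Suc N)) - R else 0)" for N x
  have pt_in: "pt N x \<in> Q R" if "\<forall>i<m. x i \<le> Suc N" for N x
  proof -
    have "0 \<le> real (x i) / real (Suc N)" "real (x i) / real (Suc N) \<le> 1" if "i < m" for i
      using \<open>\<forall>i<m. x i \<le> Suc N\<close> that by (auto simp: divide_simps)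
    then have "0 \<le> 2 * R * (real (x i) / real (Suc N))" "2 * R * (real (x i) / real (Suc N)) \<le> 2 * R" if "i < m" for i
      using that \<open>R > 0\<close> mult_left_mono[of "real (x i) / real (Suc N)" 1 "2 * R"] by auto
    then show ?thesis
      by (auto simp: Q_def pt_def PiE_iff)
  qed
  \<comment> \<open>Kuhn's lemma demands the label 0 on the face \<open>x i = 0\<close> and 1 on the
    opposite face. By \<open>low\<close> and \<open>high\<close> these labels agree with the sign of
    \<open>f i\<close> there, whence \<open>lb0\<close> and \<open>lb1\<close>.\<close>
  define lb :: "nat \<Rightarrow> (nat \<Rightarrow> nat) \<Rightarrow> nat \<Rightarrow> nat"
    where "lb N x i = (if x i = 0 then 0 else if x i = Suc N then 1 else if f i (pt N x) \<le> 0 then 0 else 1)"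
    for N x i
  have lb0: "f i (pt N x) \<le> 0" if "i < m" "\<forall>i<m. x i \<le> Suc N" "lb N x i = 0" for N x i
    using that low[OF that(1) pt_in[OF that(2)]] by (auto simp: lb_def pt_def split: if_splits)
  have lb1: "f i (pt N x) \<ge> 0" if "i < m" "\<forall>i<m. x i \<le> Suc N" "lb N x i \<noteq> 0" for N x i
    using that high[OF that(1) pt_in[OF that(2)]] by (auto simp: lb_def pt_def split: if_splits)
  have "\<exists>q. (\<forall>i<m. q i < Suc N) \<and> (\<forall>i<m. \<exists>r s. (\<forall>j<m. q j \<le> r j \<and> r j \<le> q j + 1) \<and>
      (\<forall>j<m. q j \<le> s j \<and> s j \<le> q j + 1) \<and> f i (pt N r) \<le> 0 \<and> 0 \<le> f i (pt N s))" for N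
  proof -
    obtain q where q: "\<forall>i<m. q i < Suc N" and
      rs: "\<forall>i<m. \<exists>r s. (\<forall>j<m. q j \<le> r j \<and> r j \<le> q j + 1) \<and>
          (\<forall>j<m. q j \<le> s j \<and> s j \<le> q j + 1) \<and> lb N r i \<noteq> lb N s i"
      by (rule kuhn_lemma[of "Suc N" m "lb N"]) (auto simp: lb_def)
    have "\<exists>r s. (\<forall>j<m. q j \<le> r j \<and> r j \<le> q j + 1) \<and>
      (\<forall>j<m. q j \<le> s j \<and> s j \<le> q j + 1) \<and> f i (pt N r) \<le> 0 \<and> 0 \<le> f i (pt N s)" if "i < m" for i
    proof -
      obtain r s where r: "\<forall>j<m. q j \<le> r j \<and> r j \<le> q j + 1"
        and s: "\<forall>j<m. q j \<le> s j \<and> s j \<le> q j + 1" and ne: "lb N r i \<noteq> lb N s i"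
        using rs \<open>i < m\<close> by blast
      have r': "\<forall>i<m. r i \<le> Suc N" and s': "\<forall>i<m. s i \<le> Suc N"
        using q r s by (metis Suc_eq_plus1 Suc_leI le_trans not_less_eq_eq)+
      have "lb N r i = 0 \<and> lb N s i \<noteq> 0 \<or> lb N s i = 0 \<and> lb N r i \<noteq> 0"
        using ne by (auto simp: lb_def split: if_splits)
      then show ?thesis
        using lb0[OF that r'] lb1[OF that r'] lb0[OF that s'] lb1[OF that s'] r s by blast
    qed
    with q show ?thesis by blast
  qed
  then obtain q where q: "\<And>N i. i < m \<Longrightarrow> q N i < Suc N"
    and "\<forall>N. \<forall>i<m. \<exists>r s. (\<forall>j<m. q N j \<le> r j \<and> r j \<le> q N j + 1) \<and>
      (\<forall>j<m. q N j \<le> s j \<and> s j \<le> q N j + 1) \<and> f i (pt N r) \<le> 0 \<and> 0 \<le> f i (pt N s)"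
    by metis
  then obtain r s where
    r: "\<And>N i j. i < m \<Longrightarrow> j < m \<Longrightarrow> q N j \<le> r N i j \<and> r N i j \<le> q N j + 1" and
    s: "\<And>N i j. i < m \<Longrightarrow> j < m \<Longrightarrow> q N j \<le> s N i j \<and> s N i j \<le> q N j + 1" and
    fr: "\<And>N i. i < m \<Longrightarrow> f i (pt N (r N i)) \<le> 0" and
    fs: "\<And>N i. i < m \<Longrightarrow> f i (pt N (s N i)) \<ge> 0"
    by metis
  have "compact (Q R)"
    unfolding Q_def by (rule compact_PiE_UNIV) auto
  moreover have "\<forall>N. pt N (q N) \<in> Q R"
    using q by (intro allI pt_in) (simp add: less_imp_le)
  ultimately obtain z \<phi> where z: "z \<in> Q R" and \<phi>: "strict_mono \<phi>"
    and lim: "((\<lambda>N. pt N (q N)) \<circ> \<phi>) \<longlonglongrightarrow> z"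
    by (metis (no_types, lifting) compact_eq_seq_compact_metric seq_compact_def)
  \<comment> \<open>The mesh of the grid tends to 0, so any choice of vertices of the cells at
    \<open>q N\<close> has the same limit along the subsequence.\<close>
  have near: "(\<lambda>N. pt (\<phi> N) (r' (\<phi> N))) \<longlonglongrightarrow> z"
    if r': "\<And>N j. j < m \<Longrightarrow> q N j \<le> r' N j \<and> r' N j \<le> q N j + 1" for r' :: "nat \<Rightarrow> nat \<Rightarrow> nat"
  proof -
    have "(\<lambda>N. pt (\<phi> N) (r' (\<phi> N)) i) \<longlonglongrightarrow> z i" for i
    proof -
      have 1: "(\<lambda>N. pt (\<phi> N) (q (\<phi> N)) i) \<longlonglongrightarrow> z i"
        using lim by (simp add: tendsto_fun_iff o_def)
      have 2: "(\<lambda>N. 2 * R * inverse (real (Suc (\<phi> N)))) \<longlonglongrightarrow> 0"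
        using LIMSEQ_subseq_LIMSEQ[OF tendsto_mult_right_zero[OF LIMSEQ_inverse_real_of_nat] \<phi>, of "2 * R"]
        by (simp add: o_def)
      have "norm (pt N (r' N) i - pt N (q N) i) \<le> 2 * R * inverse (real (Suc N))" for N
      proof (cases "i < m")
        case True
        have "pt N (r' N) i - pt N (q N) i = 2 * R * ((real (r' N i) - real (q N i)) / real (Suc N))"
          using True by (simp add: pt_def diff_divide_distrib right_diff_distrib)
        also have "\<bar>\<dots>\<bar> \<le> 2 * R * (1 / real (Suc N))"
          using r'[OF True, of N] \<open>R > 0\<close> by (auto simp: abs_mult divide_simps)
        finally show ?thesis by (simp add: inverse_eq_divide)
      qed (use \<open>R > 0\<close> in \<open>simp add: pt_def\<close>)
      then have "(\<lambda>N. pt (\<phi> N) (r' (\<phi> N)) i - pt (\<phi> N) (q (\<phi> N)) i) \<longlonglongrightarrow> 0"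
        by (intro Lim_null_comparison[OF _ 2]) auto
      from tendsto_add[OF this 1] show ?thesis by simp
    qed
    then show ?thesis by (simp add: tendsto_fun_iff)
  qed
  have "f k z = 0" if "k < m" for k
  proof -
    have in_Q: "pt N (r' N) \<in> Q R"
      if "\<And>N j. j < m \<Longrightarrow> q N j \<le> r' N j \<and> r' N j \<le> q N j + 1" for r' N
      using that q by (intro pt_in) (metis Suc_eq_plus1 Suc_leI le_trans not_less_eq_eq)
    have conv: "(\<lambda>N. f k (pt (\<phi> N) (r' (\<phi> N)))) \<longlonglongrightarrow> f k z"
      if "\<And>N j. j < m \<Longrightarrow> q N j \<le> r' N j \<and> r' N j \<le> q N j + 1" for r'
      by (rule continuous_on_tendsto_compose[OF cont[OF \<open>k < m\<close>] near[OF that] z])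
        (auto intro: always_eventually in_Q[OF that])
    have "f k z \<le> 0"
    proof (rule LIMSEQ_le_const2)
      show "(\<lambda>N. f k (pt (\<phi> N) (r (\<phi> N) k))) \<longlonglongrightarrow> f k z"
        by (rule conv) (rule r[OF that])
    qed (simp add: fr[OF that])
    moreover have "0 \<le> f k z"
    proof (rule LIMSEQ_le_const)
      show "(\<lambda>N. f k (pt (\<phi> N) (s (\<phi> N) k))) \<longlonglongrightarrow> f k z"
        by (rule conv) (rule s[OF that])
    qed (simp add: fs[OF that])
    ultimately show ?thesis by simp
  qed
  then show ?thesis using z by (intro bexI[of _ z]) simp_all
qed

text \<open>Pinning the coordinates from \<open>m\<close> on to 0 makes the torus a compact subset
  of the metric space \<open>nat \<Rightarrow> complex\<close>.\<close>

definition torus :: "nat \<Rightarrow> (nat \<Rightarrow> complex) set" where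
  "torus m = PiE UNIV (\<lambda>i. if i < m then sphere 0 1 else {0})"

lemma compact_torus: "compact (torus m)"
  unfolding torus_def by (rule compact_PiE_UNIV) auto

lemma norm_torus: "z \<in> torus m \<Longrightarrow> i < m \<Longrightarrow> cmod (z i) = 1"
  by (auto simp: torus_def PiE_iff split: if_splits)

text \<open>On a cube of angles a covering would turn into \<open>m\<close> equations in
  \<open>m\<close> unknowns with a contradictory solution. Branches are requested on compact sets
  only, so each \<open>U k\<close> is first shrunk to a compact \<open>K k\<close>.\<close>

lemma torus_no_cover:
  fixes U :: "nat \<Rightarrow> (nat \<Rightarrow> complex) set"
  assumes op: "\<And>k. k < m \<Longrightarrow> openin (top_of_set (torus m)) (U k)"
    and cover: "torus m \<subseteq> (\<Union>k<m. U k)"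
    and lift: "\<And>k K. k < m \<Longrightarrow> compact K \<Longrightarrow> K \<subseteq> U k \<Longrightarrow>
                 \<exists>h. continuous_on K h \<and> (\<forall>z\<in>K. z k = cis (h z))"
  shows False
proof -
  have "\<forall>k. \<exists>G. k < m \<longrightarrow> open G \<and> U k = torus m \<inter> G"
    using op by (simp add: openin_open)
  then obtain G where G: "\<And>k. k < m \<Longrightarrow> open (G k)" and UG: "\<And>k. k < m \<Longrightarrow> U k = torus m \<inter> G k"
    by metis
  \<comment> \<open>A Lebesgue number of the covering.\<close>
  have "\<exists>\<epsilon>>0. \<forall>z\<in>torus m. \<exists>k<m. ball z \<epsilon> \<subseteq> G k"
  proof (rule Heine_Borel_lemma[OF compact_torus])
    show "torus m \<subseteq> \<Union> (G ` {..<m})"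
      using cover UG by auto
    show "open T" if "T \<in> G ` {..<m}" for T
      using that G by auto
    fix \<epsilon> :: real
    assume "0 < \<epsilon>" and "\<And>z. z \<in> torus m \<Longrightarrow> \<exists>H \<in> G ` {..<m}. ball z \<epsilon> \<subseteq> H"
    then show ?thesis by (intro exI[of _ \<epsilon>]) force
  qed
  then obtain \<epsilon> where "\<epsilon> > 0" and \<epsilon>: "\<And>z. z \<in> torus m \<Longrightarrow> \<exists>k<m. ball z \<epsilon> \<subseteq> G k"
    by blast
  \<comment> \<open>The distance to the complement. As \<open>infdist\<close> to the empty set is 0,
    the constant \<epsilon> replaces it when \<open>G k\<close> is everything, so that
    \<open>\<mu>_ge\<close> holds in both cases.\<close>
  define \<mu> where "\<mu> k z = (if G k = UNIV then \<epsilon> else infdist z (- G k))" for k z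
  have cont_\<mu>: "continuous_on S (\<mu> k)" for S k
    unfolding \<mu>_def by (cases "G k = UNIV") (auto intro!: continuous_intros)
  have \<mu>_ge: "\<mu> k z \<ge> \<epsilon>" if "ball z \<epsilon> \<subseteq> G k" for k z
  proof (cases "G k = UNIV")
    case False
    then have ne: "- G k \<noteq> {}" by auto
    have "\<epsilon> \<le> dist z y" if "y \<in> - G k" for y
      using \<open>ball z \<epsilon> \<subseteq> G k\<close> that by (force simp: not_le)
    then have "\<epsilon> \<le> infdist z (- G k)"
      unfolding infdist_notempty[OF ne] by (intro cINF_greatest ne) auto
    then show ?thesis using False by (simp add: \<mu>_def)
  qed (simp add: \<mu>_def)
  have \<mu>_in: "z \<in> G k" if "\<mu> k z > 0" for k z
    using that by (auto simp: \<mu>_def split: if_splits)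
  \<comment> \<open>The threshold at half the Lebesgue number makes \<open>K k\<close> a compact
    part of \<open>U k\<close>, while the sets with \<open>\<mu> k z > \<epsilon> / 2\<close> still
    cover the torus.\<close>
  define K where "K k = {z \<in> torus m. \<epsilon> / 2 \<le> \<mu> k z}" for k
  have "compact (K k)" for k
  proof -
    have "closed {z. \<epsilon> / 2 \<le> \<mu> k z}"
      by (intro closed_Collect_le cont_\<mu> continuous_intros)
    moreover have "K k = torus m \<inter> {z. \<epsilon> / 2 \<le> \<mu> k z}"
      by (auto simp: K_def)
    ultimately show ?thesis
      by (simp add: compact_Int_closed compact_torus)
  qed
  moreover have "K k \<subseteq> U k" if "k < m" for k
    using \<mu>_in \<open>\<epsilon> > 0\<close> UG[OF that] by (force simp: K_def)
  ultimately have "\<forall>k. k < m \<longrightarrow> (\<exists>h. continuous_on (K k) h \<and> (\<forall>z\<in>K k. z k = cis (h z)))"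
    using lift by blast
  then obtain h where cont_h: "\<And>k. k < m \<Longrightarrow> continuous_on (K k) (h k)"
    and h: "\<And>k z. k < m \<Longrightarrow> z \<in> K k \<Longrightarrow> z k = cis (h k z)"
    by metis
  have "\<exists>c. \<forall>z\<in>K k. \<bar>h k z\<bar> \<le> c" if "k < m" for k
    using compact_imp_bounded[OF compact_continuous_image[OF cont_h[OF that] \<open>compact (K k)\<close>]]
    by (auto simp: bounded_iff)
  then obtain c where c: "\<And>k z. k < m \<Longrightarrow> z \<in> K k \<Longrightarrow> \<bar>h k z\<bar> \<le> c k"
    by metis
  \<comment> \<open>On the faces of the cube the angle has to outweigh every branch value even after
    the shift by \<open>pi\<close>.\<close>
  define R where "R = pi + (\<Sum>k<m. \<bar>c k\<bar>)"
  have R: "\<bar>h k z\<bar> + pi \<le> R" if "k < m" "z \<in> K k" for k z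
  proof -
    have "\<bar>c k\<bar> \<le> (\<Sum>k<m. \<bar>c k\<bar>)"
      using that by (intro member_le_sum) auto
    with c[OF that] show ?thesis by (simp add: R_def)
  qed
  have "R > 0"
    using pi_gt_zero by (simp add: R_def sum_nonneg add_pos_nonneg)
  define E :: "(nat \<Rightarrow> real) \<Rightarrow> nat \<Rightarrow> complex"
    where "E \<theta> = (\<lambda>i. if i < m then cis (\<theta> i) else 0)" for \<theta>
  have E: "E \<theta> \<in> torus m" for \<theta>
    by (auto simp: E_def torus_def)
  have "continuous_on UNIV (\<lambda>\<theta>. E \<theta> i)" for i
    unfolding E_def by (cases "i < m") (auto intro!: continuous_intros)
  then have "continuous_on UNIV E"
    by (rule continuous_on_coordinatewise_then_product)
  then have cont_E: "continuous_on S E" for S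
    by (rule continuous_on_subset) simp
  \<comment> \<open>The factor tends to 0 where \<open>\<mu> k\<close> drops to
    \<open>\<epsilon> / 2\<close>, which keeps \<open>f k\<close> continuous although
    \<open>h k\<close> is only controlled on \<open>K k\<close>. At a zero with positive factor, the
    angle would be half a turn away from a branch of itself.\<close>
  define f where "f k \<theta> = (if \<mu> k (E \<theta>) \<le> \<epsilon> / 2 then 0
      else (\<mu> k (E \<theta>) - \<epsilon> / 2) * (\<theta> k - h k (E \<theta>) + pi))" for k \<theta>
  have cont_f: "continuous_on S (f k)" if "k < m" for S k
    unfolding f_def
  proof (rule continuous_on_cases_le)
    have "continuous_on {\<theta> \<in> S. \<epsilon> / 2 \<le> \<mu> k (E \<theta>)} (\<lambda>\<theta>. h k (E \<theta>))"
      by (rule continuous_on_compose2[OF cont_h[OF that] cont_E]) (auto simp: K_def E)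
    moreover have "continuous_on A (\<lambda>\<theta>. \<mu> k (E \<theta>))" for A
      by (rule continuous_on_compose2[OF cont_\<mu>[of UNIV] cont_E]) auto
    moreover have "continuous_on A (\<lambda>\<theta>::nat \<Rightarrow> real. \<theta> k)" for A
      by (rule continuous_on_subset[OF continuous_on_product_coordinates]) simp
    ultimately show "continuous_on {\<theta> \<in> S. \<epsilon> / 2 \<le> \<mu> k (E \<theta>)}
        (\<lambda>\<theta>. (\<mu> k (E \<theta>) - \<epsilon> / 2) * (\<theta> k - h k (E \<theta>) + pi))"
      "continuous_on S (\<lambda>\<theta>. \<mu> k (E \<theta>))"
      by (auto intro!: continuous_intros)
  qed auto
  have "\<exists>\<theta> \<in> PiE UNIV (\<lambda>i. if i < m then {-R..R} else {0}). \<forall>k<m. f k \<theta> = 0"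
  proof (rule poincare_miranda[OF \<open>R > 0\<close> cont_f])
    fix k \<theta> assume "k < m"
    have *: "\<bar>h k (E \<theta>)\<bar> + pi \<le> R" if "\<not> \<mu> k (E \<theta>) \<le> \<epsilon> / 2"
      using that by (intro R \<open>k < m\<close>) (auto simp: K_def E)
    show "f k \<theta> \<le> 0" if "\<theta> k = - R"
    proof (cases "\<mu> k (E \<theta>) \<le> \<epsilon> / 2")
      case False
      then have "\<theta> k - h k (E \<theta>) + pi \<le> 0" using * that by linarith
      then show ?thesis using False by (simp add: f_def mult_nonneg_nonpos)
    qed (simp add: f_def)
    show "f k \<theta> \<ge> 0" if "\<theta> k = R"
    proof (cases "\<mu> k (E \<theta>) \<le> \<epsilon> / 2")
      case False
      then have "\<theta> k - h k (E \<theta>) + pi \<ge> 0" using * that pi_gt_zero by linarith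
      then show ?thesis using False by (simp add: f_def)
    qed (simp add: f_def)
  qed
  then obtain \<theta> where \<theta>: "\<And>k. k < m \<Longrightarrow> f k \<theta> = 0" by blast
  \<comment> \<open>By the choice of \<epsilon>, at least one of the factors is positive at the
    common zero.\<close>
  obtain k where "k < m" "ball (E \<theta>) \<epsilon> \<subseteq> G k"
    using \<epsilon>[OF E] by blast
  then have \<mu>: "\<mu> k (E \<theta>) > \<epsilon> / 2"
    using \<mu>_ge \<open>\<epsilon> > 0\<close> by fastforce
  then have "\<theta> k = h k (E \<theta>) - pi"
    using \<theta>[OF \<open>k < m\<close>] by (auto simp: f_def)
  moreover have "cis (\<theta> k) = cis (h k (E \<theta>))"
    using h[OF \<open>k < m\<close>, of "E \<theta>"] \<mu> \<open>k < m\<close> E by (auto simp: K_def E_def)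
  ultimately have "cis (h k (E \<theta>)) = - cis (h k (E \<theta>))"
    by (simp add: cis_divide[symmetric])
  then show False
    by simp
qed

subsection \<open>A torus of configurations\<close>

text \<open>The quotient of \<open>f (z, w)\<close> by \<open>f (z, u)\<close> is homotopic to 1
  through nonvanishing functions on \<open>K\<close>. Concretely, on a fine subdivision all
  consecutive quotients are close to 1, where \<open>Ln\<close> is continuous, and their logarithms
  add up.\<close>

lemma log_along_path:
  fixes f :: "'a::metric_space \<times> real \<Rightarrow> complex"
  assumes "compact K" and cont: "continuous_on (K \<times> {0..1}) f"
    and nz: "\<And>z v. z \<in> K \<Longrightarrow> v \<in> {0..1} \<Longrightarrow> f (z, v) \<noteq> 0"
    and "u \<in> {0..1}" "w \<in> {0..1}"
  shows "\<exists>g. continuous_on K g \<and> (\<forall>z\<in>K. f (z, w) = f (z, u) * exp (g z))"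
proof (cases "K = {}")
  case False
  \<comment> \<open>Reparametrised to run from \<open>u\<close> at time 0 to \<open>w\<close> at
    time 1, in whichever order the two lie.\<close>
  define F where "F x = f (fst x, (1 - snd x) * u + snd x * w)" for x
  have seg: "(1 - v) * u + v * w \<in> {0..1}" if "v \<in> {0..1}" for v
    using convexD_alt[OF convex_closed_interval[of 0 1] \<open>u \<in> {0..1}\<close> \<open>w \<in> {0..1}\<close>, of v] that by simp
  have cont_F: "continuous_on (K \<times> {0..1}) F"
    unfolding F_def
  proof (rule continuous_on_compose2[OF cont])
    show "continuous_on (K \<times> {0..1}) (\<lambda>x. (fst x, (1 - snd x) * u + snd x * w))"
      by (intro continuous_intros)
    show "(\<lambda>x. (fst x, (1 - snd x) * u + snd x * w)) ` (K \<times> {0..1}) \<subseteq> K \<times> {0..1}"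
      using seg by (simp add: image_subset_iff mem_Times_iff)
  qed
  have nz_F: "F x \<noteq> 0" if "x \<in> K \<times> {0..1}" for x
    using that seg nz by (auto simp: F_def)
  have "compact (K \<times> {0..1::real})"
    by (simp add: compact_Times \<open>compact K\<close>)
  moreover have "K \<times> {0..1::real} \<noteq> {}" using False by auto
  \<comment> \<open>The least modulus of \<open>F\<close> is the tolerance for uniform continuity:
    one step of the subdivision then changes \<open>F\<close> by less than its own modulus, so each
    quotient lies in the unit disc around 1.\<close>
  ultimately obtain x0 where "x0 \<in> K \<times> {0..1}" and x0: "\<And>x. x \<in> K \<times> {0..1} \<Longrightarrow> cmod (F x0) \<le> cmod (F x)"
    using continuous_attains_inf[of "K \<times> {0..1}" "\<lambda>x. cmod (F x)"] cont_F
    by (metis continuous_on_norm)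
  then have "cmod (F x0) > 0" using nz_F by simp
  have "uniformly_continuous_on (K \<times> {0..1}) F"
    by (rule compact_uniformly_continuous[OF cont_F \<open>compact (K \<times> {0..1})\<close>])
  then obtain \<delta> where "\<delta> > 0" and
    \<delta>: "\<And>x x'. x \<in> K \<times> {0..1} \<Longrightarrow> x' \<in> K \<times> {0..1} \<Longrightarrow> dist x' x < \<delta> \<Longrightarrow> dist (F x') (F x) < cmod (F x0)"
    using \<open>cmod (F x0) > 0\<close> unfolding uniformly_continuous_on_def by blast
  obtain N where N: "inverse (real (Suc N)) < \<delta>"
    using reals_Archimedean[OF \<open>\<delta> > 0\<close>] by blast
  have "\<exists>g. continuous_on K g \<and> (\<forall>z\<in>K. F (z, real l / real (Suc N)) = F (z, 0) * exp (g z))"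
    if "l \<le> Suc N" for l
    using that
  proof (induction l)
    case 0
    show ?case by (intro exI[of _ "\<lambda>_. 0"]) simp
  next
    case (Suc l)
    then obtain g where g: "continuous_on K g"
      "\<And>z. z \<in> K \<Longrightarrow> F (z, real l / real (Suc N)) = F (z, 0) * exp (g z)"
      by auto
    define q where "q z = F (z, real (Suc l) / real (Suc N)) / F (z, real l / real (Suc N))" for z
    have in01: "real l / real (Suc N) \<in> {0..1}" "real (Suc l) / real (Suc N) \<in> {0..1}"
      using Suc.prems by auto
    have cont_q: "continuous_on K q"
      unfolding q_def using in01 nz_F
      by (intro continuous_intros continuous_on_compose2[OF cont_F]) auto
    have q: "q z \<noteq> 0" "q z \<notin> \<real>\<^sub>\<le>\<^sub>0" if "z \<in> K" for z
    proof -
      let ?a = "F (z, real l / real (Suc N))" and ?b = "F (z, real (Suc l) / real (Suc N))"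
      have "dist (z, real (Suc l) / real (Suc N)) (z, real l / real (Suc N)) = inverse (real (Suc N))"
        by (simp add: dist_prod_def dist_real_def add_divide_distrib inverse_eq_divide)
      then have "dist ?b ?a < cmod (F x0)"
        using \<delta>[of "(z, real l / real (Suc N))" "(z, real (Suc l) / real (Suc N))"] N that in01 by auto
      also have "\<dots> \<le> cmod ?a"
        using that in01 by (intro x0) auto
      finally have *: "cmod (?b - ?a) < cmod ?a" by (simp add: dist_norm)
      have "?a \<noteq> 0" "?b \<noteq> 0" using that in01 nz_F by auto
      then have "q z - 1 = (?b - ?a) / ?a" by (simp add: q_def diff_divide_distrib)
      then have "cmod (q z - 1) < 1" using * \<open>?a \<noteq> 0\<close> by (simp add: norm_divide)
      then have "Re (q z) > 0"
        using abs_Re_le_cmod[of "q z - 1"] by simp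
      then show "q z \<noteq> 0" "q z \<notin> \<real>\<^sub>\<le>\<^sub>0"
        by (auto simp: complex_nonpos_Reals_iff)
    qed
    have "continuous_on K (\<lambda>z. g z + Ln (q z))"
      by (intro continuous_intros g cont_q continuous_on_Ln') (use q in auto)
    moreover have "F (z, real (Suc l) / real (Suc N)) = F (z, 0) * exp (g z + Ln (q z))" if "z \<in> K" for z
    proof -
      have "F (z, real l / real (Suc N)) \<noteq> 0" using that in01 nz_F by auto
      then have "F (z, real (Suc l) / real (Suc N)) = F (z, real l / real (Suc N)) * q z"
        by (simp add: q_def)
      also have "\<dots> = F (z, 0) * exp (g z) * exp (Ln (q z))"
        using g(2)[OF that] q(1)[OF that] by simp
      finally show ?thesis by (simp add: exp_add)
    qed
    ultimately show ?case by blast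
  qed
  from this[of "Suc N"] show ?thesis by (simp add: F_def)
qed simp

text \<open>The right half-plane avoids the cut of \<open>Ln\<close>. On the left one,
  \<open>Ln\<close> is applied to the negative and corrected by half a turn.\<close>

lemma continuous_log_of_half_plane:
  fixes f :: "'a::topological_space \<Rightarrow> complex"
  assumes "continuous_on S f" and "(\<forall>z\<in>S. Re (f z) > 0) \<or> (\<forall>z\<in>S. Re (f z) < 0)"
  shows "\<exists>g. continuous_on S g \<and> (\<forall>z\<in>S. f z = exp (g z))"
  using assms(2)
proof
  assume *: "\<forall>z\<in>S. Re (f z) > 0"
  have "continuous_on S (\<lambda>z. Ln (f z))"
    using * by (intro continuous_on_Ln' assms) (auto simp: complex_nonpos_Reals_iff)
  moreover have "f z = exp (Ln (f z))" if "z \<in> S" for z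
    using * that by (subst exp_Ln) auto
  ultimately show ?thesis by blast
next
  assume *: "\<forall>z\<in>S. Re (f z) < 0"
  have "continuous_on S (\<lambda>z. \<i> * of_real pi + Ln (- f z))"
    using * by (intro continuous_intros continuous_on_Ln' assms) (auto simp: complex_nonpos_Reals_iff)
  moreover have "f z = exp (\<i> * of_real pi + Ln (- f z))" if "z \<in> S" for z
  proof -
    have "f z \<noteq> 0" using * that by auto
    then show ?thesis by (simp add: exp_add)
  qed
  ultimately show ?thesis by blast
qed

text \<open>With indices from 0, the two centres are point 0 at the origin and point
  \<open>s - 1\<close> at \<open>s + 1\<close>. The first \<open>n * t\<close> angles drive the
  moving points, \<open>t\<close> for each configuration \<open>j\<close>; the remaining
  \<open>s - 2\<close> drive the fixed points 1 to \<open>s - 2\<close>. The radii \<open>i\<close>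
  and \<open>1 / (i - s + 2)\<close> differ from each other, which prevents collisions.\<close>

definition torus_config :: "nat \<Rightarrow> nat \<Rightarrow> nat \<Rightarrow> (nat \<Rightarrow> complex) \<Rightarrow> nat \<Rightarrow> nat \<Rightarrow> complex" where
  "torus_config s t n z j i =
     (if i = 0 then 0
      else if i < s - 1 then of_nat i * z (n * t + i - 1)
      else if i = s - 1 then of_nat (s + 1)
      else (if j = 0 then 0 else of_nat (s + 1)) + z (j * t + (i - s)) / of_nat (i - s + 2))"

lemma mult_add_less_mult:
  fixes j t a n :: nat
  assumes "j < n" "a < t"
  shows "j * t + a < n * t"
proof -
  have "j * t + a < Suc j * t" using assms by simp
  also have "\<dots> \<le> n * t" using assms by (intro mult_le_mono1) simp
  finally show ?thesis .
qed

text \<open>Only distances are compared: the fixed points have distinct distances from the origin,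
  the moving points of one configuration have distinct distances, at most 1/2, from their centre,
  and every other fixed point is at distance at least 1 from that centre.\<close>

lemma torus_config_neq:
  fixes s t n :: nat
  assumes "2 \<le> s" and z: "z \<in> torus (n * t + s - 2)"
    and "j < n" "i < s + t" "i' < s + t" "i \<noteq> i'"
  shows "torus_config s t n z j i \<noteq> torus_config s t n z j i'"
proof -
  let ?c = "torus_config s t n z j" and ?S = "of_nat (s + 1) :: complex"
  have nx: "cmod (z (n * t + i - 1)) = 1" if "0 < i" "i < s - 1" for i
    using that by (intro norm_torus[OF z]) auto
  have ny: "cmod (z (j * t + (i - s))) = 1" if "s \<le> i" "i < s + t" for i
  proof (rule norm_torus[OF z])
    have "i - s < t" using that by simp
    from mult_add_less_mult[OF \<open>j < n\<close> this] \<open>2 \<le> s\<close>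
    show "j * t + (i - s) < n * t + s - 2" by linarith
  qed
  define \<rho> where "\<rho> i = (if i < s - 1 then real i else real (s + 1))" for i
  have x: "cmod (?c i) = \<rho> i" if "i < s" for i
    using that nx \<open>2 \<le> s\<close> by (auto simp: torus_config_def \<rho>_def norm_mult simp del: of_nat_Suc of_nat_add)
  have y: "cmod (?c i - (if j = 0 then 0 else ?S)) = 1 / real (i - s + 2)" if "s \<le> i" "i < s + t" for i
    using that ny \<open>2 \<le> s\<close> by (auto simp: torus_config_def norm_divide simp del: of_nat_Suc of_nat_add)
  have xx: "?c i \<noteq> ?c i'" if "i < s" "i' < s" "i \<noteq> i'" for i i'
  proof -
    have "\<rho> i \<noteq> \<rho> i'"
      using that by (auto simp: \<rho>_def)
    then show ?thesis using x that by metis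
  qed
  have yy: "?c i \<noteq> ?c i'" if "s \<le> i" "s \<le> i'" "i < s + t" "i' < s + t" "i \<noteq> i'" for i i'
  proof
    assume "?c i = ?c i'"
    then have "1 / real (i - s + 2) = 1 / real (i' - s + 2)"
      using y that by metis
    then show False using that by (auto simp: divide_simps)
  qed
  have xy: "?c i \<noteq> ?c i'" if "i < s" "s \<le> i'" "i' < s + t" for i i'
  proof
    assume eq: "?c i = ?c i'"
    have le: "1 / real (i' - s + 2) \<le> 1 / 2" and pos: "0 < 1 / real (i' - s + 2)"
      by (auto simp: divide_simps)
    show False
    proof (cases "j = 0")
      case True
      then have "\<rho> i = 1 / real (i' - s + 2)"
        using y[of i'] x[of i] that eq by simp
      moreover have "\<rho> i = 0 \<or> 1 \<le> \<rho> i" by (auto simp: \<rho>_def)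
      ultimately show False using le pos by linarith
    next
      case False
      then have *: "cmod (?c i - ?S) = 1 / real (i' - s + 2)"
        using y[of i'] that eq by simp
      show False
      proof (cases "i = s - 1")
        case True
        then show False using * pos \<open>2 \<le> s\<close> by (simp add: torus_config_def)
      next
        case False
        \<comment> \<open>A fixed point other than \<open>s - 1\<close> stays at distance at least 3
          from the centre \<open>s + 1\<close>.\<close>
        then have "cmod (?c i) \<le> real s - 2"
          using x[of i] that by (auto simp: \<rho>_def)
        moreover have "cmod ?S = real s + 1"
          by (metis norm_of_nat of_nat_add of_nat_1)
        moreover have "cmod ?S \<le> cmod (?c i) + cmod (?c i - ?S)"
          by (metis norm_minus_commute norm_triangle_sub)
        ultimately show False using * le by linarith
      qed
    qed
  qed
  show ?thesis
    using assms xx[of i i'] yy[of i i'] xy[of i i'] xy[of i' i] by (metis not_less)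
qed

lemma continuous_on_torus_config: "continuous_on S (\<lambda>z. torus_config s t n z j i)"
proof -
  have "continuous_on S (\<lambda>z::nat \<Rightarrow> complex. z k)" for k
    by (rule continuous_on_subset[OF continuous_on_product_coordinates]) simp
  then show ?thesis
    unfolding torus_config_def
    by (cases "i = 0"; cases "i < s - 1"; cases "i = s - 1"; cases "j = 0")
      (auto intro!: continuous_intros simp del: of_nat_add of_nat_Suc)
qed

text \<open>
  Along each coordinate circle, some pair of points winds once in one configuration and does not wind
  in another one.
\<close>

lemma torus_config_winding:
  fixes s t n k :: nat
  defines "m \<equiv> n * t + s - 2"
  assumes "2 \<le> s" "1 \<le> t" "2 \<le> n" "k < m"
  shows "\<exists>j j' a i p q. j < n \<and> j' < n \<and> a < s + t \<and> i < s + t \<and> a \<noteq> i \<and>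
           continuous_on (torus m) p \<and> continuous_on (torus m) q \<and>
           (\<forall>z\<in>torus m. torus_config s t n z j a - torus_config s t n z j i = z k * exp (p z) \<and>
              torus_config s t n z j' a - torus_config s t n z j' i = exp (q z))"
proof -
  let ?c = "torus_config s t n"
  note st = \<open>2 \<le> s\<close> \<open>1 \<le> t\<close> \<open>2 \<le> n\<close>
  have coord: "continuous_on S (\<lambda>z::nat \<Rightarrow> complex. z l)" for S l
    by (rule continuous_on_subset[OF continuous_on_product_coordinates]) simp
  \<comment> \<open>Both logarithms come from half-planes: in configuration \<open>j\<close> what
    remains after removing the factor \<open>z k\<close> has positive real part, and in
    configuration \<open>j'\<close> the difference stays in one half-plane.\<close>
  have main: ?thesis
    if idx: "j < n" "j' < n" "a < s + t" "i < s + t" "a \<noteq> i" and P: "continuous_on (torus m) P"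
      "\<And>z. z \<in> torus m \<Longrightarrow> Re (P z) > 0"
      and N: "\<And>z. z \<in> torus m \<Longrightarrow> ?c z j a - ?c z j i = z k * P z"
      and D: "(\<forall>z\<in>torus m. Re (?c z j' a - ?c z j' i) > 0) \<or> (\<forall>z\<in>torus m. Re (?c z j' a - ?c z j' i) < 0)"
    for j j' a i P
  proof -
    obtain p where "continuous_on (torus m) p" "\<forall>z\<in>torus m. P z = exp (p z)"
      using continuous_log_of_half_plane[OF P(1)] P(2) by blast
    moreover obtain q where "continuous_on (torus m) q" "\<forall>z\<in>torus m. ?c z j' a - ?c z j' i = exp (q z)"
      using continuous_log_of_half_plane[OF continuous_on_diff[OF continuous_on_torus_config continuous_on_torus_config] D]
      by blast
    ultimately show ?thesis
      using idx N by (intro exI[of _ j] exI[of _ j'] exI[of _ a] exI[of _ i] exI[of _ p] exI[of _ q] conjI ballI) simp_all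
  qed
  have re: "\<bar>Re (z l)\<bar> \<le> 1" if "z \<in> torus m" "l < m" for z l
    using abs_Re_le_cmod[of "z l"] norm_torus[OF that] by simp
  have yc: "?c z j (s + b) = (if j = 0 then 0 else of_nat (s + 1)) + z (j * t + b) / of_nat (b + 2)" for z j b
  proof -
    have "s + b \<noteq> 0" "\<not> s + b < s - 1" "s + b \<noteq> s - 1" using \<open>2 \<le> s\<close> by linarith+
    then show ?thesis
      by (simp only: torus_config_def if_False add_diff_cancel_left')
  qed
  have x0: "?c z j 0 = 0" for z j
    by (simp add: torus_config_def)
  have "s - 1 \<noteq> 0" using \<open>2 \<le> s\<close> by simp
  then have xs: "?c z j (s - 1) = of_nat (s + 1)" for z j
    unfolding torus_config_def by simp
  have half: "\<bar>Re (z l / of_nat (b + 2))\<bar> \<le> 1 / 2" if "z \<in> torus m" "l < m" for z l and b :: nat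
  proof -
    have "\<bar>Re (z l / of_nat (b + 2))\<bar> \<le> cmod (z l / of_nat (b + 2))"
      by (rule abs_Re_le_cmod)
    also have "\<dots> = 1 / real (b + 2)"
      by (simp only: norm_divide norm_torus[OF that] norm_of_nat)
    also have "\<dots> \<le> 1 / 2" by (auto simp: divide_simps)
    finally show ?thesis .
  qed
  have "t < n * t" "0 < n * t"
    using assms by auto
  have "n * t \<le> m" using \<open>2 \<le> s\<close> by (simp add: m_def)
  show ?thesis
  proof (cases "k < n * t")
    case True
    define j b where "j = k div t" and "b = k mod t"
    have jb: "j < n" "b < t" "j * t + b = k"
      using True \<open>1 \<le> t\<close> by (auto simp: j_def b_def less_mult_imp_div_less)
    show ?thesis
    proof (cases "j = 0")
      case True
      have "t + b < m"
        using mult_add_less_mult[of 1 n b t] jb(2) \<open>2 \<le> n\<close> \<open>n * t \<le> m\<close> by simp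
      \<comment> \<open>A moving point of configuration 0 circles around the origin; in
        configuration 1 it stays near \<open>s + 1\<close>, to the right of the origin.\<close>
      show ?thesis
      proof (rule main[of 0 1 "s + b" 0 "\<lambda>_. 1 / of_nat (b + 2)"])
        show "Re (1 / of_nat (b + 2)) > 0"
          by (simp add: Re_divide_of_nat del: of_nat_add of_nat_Suc)
        show "?c z 0 (s + b) - ?c z 0 0 = z k * (1 / of_nat (b + 2))" for z
          using jb True by (simp add: yc x0)
        have "Re (?c z 1 (s + b) - ?c z 1 0) > 0" if "z \<in> torus m" for z
        proof -
          have "Re (?c z 1 (s + b) - ?c z 1 0) = real s + 1 + Re (z (t + b) / of_nat (b + 2))"
            by (simp add: yc x0)
          then show ?thesis using half[OF that \<open>t + b < m\<close>, of b] by linarith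
        qed
        then show "(\<forall>z\<in>torus m. Re (?c z 1 (s + b) - ?c z 1 0) > 0) \<or>
            (\<forall>z\<in>torus m. Re (?c z 1 (s + b) - ?c z 1 0) < 0)" by blast
      qed (use st jb in simp_all)
    next
      case False
      have "b < m"
        using jb(2) \<open>t < n * t\<close> \<open>n * t \<le> m\<close> by linarith
      \<comment> \<open>A moving point of a later configuration circles around \<open>s + 1\<close>;
        in configuration 0 it stays near the origin, to the left of \<open>s + 1\<close>.\<close>
      show ?thesis
      proof (rule main[of j 0 "s + b" "s - 1" "\<lambda>_. 1 / of_nat (b + 2)"])
        show "Re (1 / of_nat (b + 2)) > 0"
          by (simp add: Re_divide_of_nat del: of_nat_add of_nat_Suc)
        show "?c z j (s + b) - ?c z j (s - 1) = z k * (1 / of_nat (b + 2))" for z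
          unfolding yc xs using jb False by simp
        have "Re (?c z 0 (s + b) - ?c z 0 (s - 1)) < 0" if "z \<in> torus m" for z
        proof -
          have "Re (?c z 0 (s + b) - ?c z 0 (s - 1)) = Re (z b / of_nat (b + 2)) - real s - 1"
            unfolding yc xs by simp
          then show ?thesis using half[OF that \<open>b < m\<close>, of b] by linarith
        qed
        then show "(\<forall>z\<in>torus m. Re (?c z 0 (s + b) - ?c z 0 (s - 1)) > 0) \<or>
            (\<forall>z\<in>torus m. Re (?c z 0 (s + b) - ?c z 0 (s - 1)) < 0)" by blast
      qed (use st jb in simp_all)
    qed
  next
    case False
    define i where "i = k - n * t + 1"
    have i: "0 < i" "i < s - 1" "n * t + i - 1 = k"
      using False \<open>k < m\<close> by (auto simp: i_def m_def)
    have xi: "?c z j i = of_nat i * z k" for z j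
      using i by (simp add: torus_config_def)
    have "0 < m" "t < m" using \<open>t < n * t\<close> \<open>n * t \<le> m\<close> by linarith+
    \<comment> \<open>The fixed point \<open>i\<close> is compared with the first moving point. In
      configuration 0 the latter is within 1/2 of the origin, so the difference turns with
      \<open>z k\<close>; in configuration 1 it is near \<open>s + 1\<close>, far to the right of
      point \<open>i\<close>. The factor \<open>P\<close> uses that \<open>cnj (z k)\<close> is the
      inverse of \<open>z k\<close>.\<close>
    show ?thesis
    proof (rule main[of 0 1 i "s + 0" "\<lambda>z. of_nat i - z 0 / of_nat (0 + 2) * cnj (z k)"])
      show "continuous_on (torus m) (\<lambda>z. of_nat i - z 0 / of_nat (0 + 2) * cnj (z k))"
        by (intro continuous_intros coord) auto
      fix z assume z: "z \<in> torus m"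
      have "cmod (z 0 / of_nat (0 + 2) * cnj (z k)) = 1 / 2"
        using norm_torus[OF z \<open>0 < m\<close>] norm_torus[OF z \<open>k < m\<close>] by (simp add: norm_mult norm_divide)
      then have "Re (z 0 / of_nat (0 + 2) * cnj (z k)) \<le> 1 / 2"
        by (metis complex_Re_le_cmod)
      then show "Re (of_nat i - z 0 / of_nat (0 + 2) * cnj (z k)) > 0"
        using i(1) by simp
      have "z k * cnj (z k) = 1"
        using norm_torus[OF z \<open>k < m\<close>] by (simp add: complex_norm_square[symmetric])
      then have "z k * (w * cnj (z k)) = w" for w
        by (metis mult.left_commute mult.right_neutral)
      then show "?c z 0 i - ?c z 0 (s + 0) = z k * (of_nat i - z 0 / of_nat (0 + 2) * cnj (z k))"
        unfolding xi yc right_diff_distrib by (simp add: mult.commute)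
    next
      have "Re (?c z 1 i - ?c z 1 (s + 0)) < 0" if z: "z \<in> torus m" for z
      proof -
        have "real i * Re (z k) \<le> real i * 1"
          using re[OF z \<open>k < m\<close>] by (intro mult_left_mono) auto
        moreover have "real i \<le> real s - 2" using i by linarith
        moreover have "Re (?c z 1 i - ?c z 1 (s + 0))
            = real i * Re (z k) - real s - 1 - Re (z t / of_nat (0 + 2))"
          unfolding xi yc by simp
        ultimately show ?thesis
          using half[OF z \<open>t < m\<close>, of 0] by linarith
      qed
      then show "(\<forall>z\<in>torus m. Re (?c z 1 i - ?c z 1 (s + 0)) > 0) \<or>
            (\<forall>z\<in>torus m. Re (?c z 1 i - ?c z 1 (s + 0)) < 0)" by blast
    qed (use st i(1,2) in linarith)+
  qed
qed

subsection \<open>Function spaces and configuration spaces\<close>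

text \<open>By the tube lemma: if \<open>f y\<close> maps the compact \<open>K\<close> into
  \<open>W\<close>, so does \<open>f y'\<close> for all \<open>y'\<close> near
  \<open>y\<close>.\<close>

lemma continuous_map_curry_compact_open:
  assumes "continuous_map (prod_topology Y X) Z (\<lambda>(y, x). f y x)"
  shows "continuous_map Y (compact_open_topology X Z) (\<lambda>y. restrict (f y) (topspace X))"
proof -
  have maps: "restrict (f y) (topspace X) \<in> continuous_maps X Z" if "y \<in> topspace Y" for y
  proof -
    have "continuous_map X (prod_topology Y X) (\<lambda>x. (y, x))"
      using that by (simp add: continuous_map_pairedI)
    then have "continuous_map X Z (f y)"
      using continuous_map_compose[OF _ assms] by (fastforce simp: o_def)
    then have "continuous_map X Z (restrict (f y) (topspace X))"
      by (rule continuous_map_eq) simp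
    then show ?thesis by (simp add: continuous_maps_def)
  qed
  show ?thesis
    unfolding compact_open_topology_def
  proof (rule continuous_on_generated_topo)
    fix V assume "V \<in> {{g \<in> continuous_maps X Z. g ` K \<subseteq> W} | K W. compactin X K \<and> openin Z W}"
    then obtain K W where V: "V = {g \<in> continuous_maps X Z. g ` K \<subseteq> W}"
      and K: "compactin X K" and W: "openin Z W" by blast
    have KX: "K \<subseteq> topspace X" using K by (rule compactin_subset_topspace)
    let ?O = "{p \<in> topspace (prod_topology Y X). (case p of (y, x) \<Rightarrow> f y x) \<in> W}"
    have O: "openin (prod_topology Y X) ?O"
      using assms W by (rule openin_continuous_map_preimage)
    have "\<exists>T. openin Y T \<and> y \<in> T \<and> T \<subseteq> (\<lambda>y. restrict (f y) (topspace X)) -` V \<inter> topspace Y"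
      if y: "y \<in> (\<lambda>y. restrict (f y) (topspace X)) -` V \<inter> topspace Y" for y
    proof -
      have "f y x \<in> W" if "x \<in> K" for x
        using y KX that by (auto simp: V restrict_def image_subset_iff subset_iff)
      then have "{y} \<times> K \<subseteq> ?O"
        using y KX by auto
      then obtain A B where "openin Y A" "openin X B" "y \<in> A" "K \<subseteq> B" and sub: "A \<times> B \<subseteq> ?O"
        using tube_lemma_right[OF O K, of y] y by blast
      have "f y' x \<in> W" if "y' \<in> A" "x \<in> K" for y' x
      proof -
        have "(y', x) \<in> ?O"
          using \<open>K \<subseteq> B\<close> that by (intro subsetD[OF sub]) auto
        then show ?thesis by simp
      qed
      moreover have "A \<subseteq> topspace Y"
        using \<open>openin Y A\<close> by (rule openin_subset)
      ultimately have "A \<subseteq> (\<lambda>y. restrict (f y) (topspace X)) -` V \<inter> topspace Y"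
        using maps KX by (auto simp: V restrict_def image_subset_iff subset_iff)
      with \<open>openin Y A\<close> \<open>y \<in> A\<close> show ?thesis by blast
    qed
    then show "openin Y ((\<lambda>y. restrict (f y) (topspace X)) -` V \<inter> topspace Y)"
      by (subst openin_subopen) blast
  next
    show "(\<lambda>y. restrict (f y) (topspace X)) ` topspace Y
        \<subseteq> \<Union> {{g \<in> continuous_maps X Z. g ` K \<subseteq> W} | K W. compactin X K \<and> openin Z W}"
    proof
      fix g assume "g \<in> (\<lambda>y. restrict (f y) (topspace X)) ` topspace Y"
      then have "g \<in> continuous_maps X Z" using maps by blast
      then have "g \<in> topspace (compact_open_topology X Z)"
        by (simp add: topspace_compact_open_topology)
      then show "g \<in> \<Union> {{g \<in> continuous_maps X Z. g ` K \<subseteq> W} | K W. compactin X K \<and> openin Z W}"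
        by (simp only: compact_open_topology_def topology_generated_by_topspace)
    qed
  qed
qed

text \<open>Local compactness and regularity put a compact neighbourhood \<open>K\<close> of
  \<open>x\<close> inside the preimage of \<open>W\<close> under \<open>g y\<close>; the functions
  mapping \<open>K\<close> into \<open>W\<close> form a subbasic open set around
  \<open>g y\<close>.\<close>

lemma continuous_map_uncurry_compact_open:
  assumes g: "continuous_map Y (compact_open_topology X Z) g"
    and X: "locally_compact_space X" "regular_space X"
  shows "continuous_map (prod_topology Y X) Z (\<lambda>(y, x). g y x)"
proof -
  have gy: "g y \<in> continuous_maps X Z" if "y \<in> topspace Y" for y
    using continuous_map_funspace[OF g] that by (auto simp: topspace_compact_open_topology)
  have base: "neighbourhood_base_of (\<lambda>C. compactin X C \<and> closedin X C) X"
    using X locally_compact_regular_space_neighbourhood_base by blast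
  let ?h = "\<lambda>(y, x). g y x"
  have "openin (prod_topology Y X) {q \<in> topspace (prod_topology Y X). ?h q \<in> W}"
    if W: "openin Z W" for W
  proof (subst openin_subopen, intro ballI)
    fix q assume "q \<in> {q \<in> topspace (prod_topology Y X). ?h q \<in> W}"
    then obtain y x where q: "q = (y, x)" and y: "y \<in> topspace Y" and x: "x \<in> topspace X"
      and gyx: "g y x \<in> W" by auto
    have "openin X {x \<in> topspace X. g y x \<in> W}"
      using gy[OF y] W by (auto simp: continuous_maps_def openin_continuous_map_preimage)
    then obtain A K where A: "openin X A" "x \<in> A" "A \<subseteq> K" and K: "compactin X K"
      and KW: "K \<subseteq> {x \<in> topspace X. g y x \<in> W}"
      using base[unfolded neighbourhood_base_of, rule_format, of "{x \<in> topspace X. g y x \<in> W}" x] x gyx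
      by auto
    have "openin (compact_open_topology X Z) {f \<in> continuous_maps X Z. f ` K \<subseteq> W}"
      unfolding compact_open_topology_def
      using K W by (intro topology_generated_by_Basis) blast
    then have B: "openin Y {y \<in> topspace Y. g y \<in> {f \<in> continuous_maps X Z. f ` K \<subseteq> W}}"
      by (rule openin_continuous_map_preimage[OF g])
    let ?B = "{y \<in> topspace Y. g y \<in> {f \<in> continuous_maps X Z. f ` K \<subseteq> W}}"
    have "openin (prod_topology Y X) (?B \<times> A)"
      using A(1) B by (simp add: openin_prod_Times_iff)
    moreover have "q \<in> ?B \<times> A"
      using y A(2) gy[OF y] KW by (auto simp: q)
    moreover have "?B \<times> A \<subseteq> {q \<in> topspace (prod_topology Y X). ?h q \<in> W}"
      using A openin_subset[OF A(1)] by auto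
    ultimately show "\<exists>T. openin (prod_topology Y X) T \<and> q \<in> T \<and>
        T \<subseteq> {q \<in> topspace (prod_topology Y X). ?h q \<in> W}"
      by blast
  qed
  moreover have "?h \<in> topspace (prod_topology Y X) \<rightarrow> topspace Z"
    using gy by (auto simp: continuous_maps_def continuous_map_def)
  ultimately show ?thesis by (simp add: continuous_map_def)
qed

section \<open>Continuity into and out of configuration spaces and fibre powers\<close>

lemma topspace_configuration_space:
  "topspace (configuration_space X k) =
     {x \<in> PiE {..<k} (\<lambda>_. topspace X). \<forall>i<k. \<forall>j<k. i \<noteq> j \<longrightarrow> x i \<noteq> x j}"
  by (auto simp: configuration_space_def)

lemma topspace_fibre_power:
  "topspace (fibre_power n E p) =
     {e \<in> PiE {..<n} (\<lambda>_. topspace E). \<forall>i<n. \<forall>j<n. p (e i) = p (e j)}"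
  by (auto simp: fibre_power_def)

lemma continuous_map_into_configuration_space:
  assumes "\<And>i. i < k \<Longrightarrow> continuous_map Y X (\<lambda>y. f y i)"
    and "\<And>y i. y \<in> topspace Y \<Longrightarrow> \<not> i < k \<Longrightarrow> f y i = undefined"
    and "\<And>y i j. y \<in> topspace Y \<Longrightarrow> i < k \<Longrightarrow> j < k \<Longrightarrow> i \<noteq> j \<Longrightarrow> f y i \<noteq> f y j"
  shows "continuous_map Y (configuration_space X k) f"
  unfolding configuration_space_def continuous_map_in_subtopology
proof
  show "continuous_map Y (product_topology (\<lambda>_. X) {..<k}) f"
    by (rule continuous_map_coordinatewise_then_product) (simp_all add: assms)
qed (use assms(3) in \<open>simp add: Pi_iff image_subset_iff\<close>)

lemma continuous_map_into_fibre_power: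
  assumes "\<And>i. i < n \<Longrightarrow> continuous_map Y E (\<lambda>y. f y i)"
    and "\<And>y i. y \<in> topspace Y \<Longrightarrow> \<not> i < n \<Longrightarrow> f y i = undefined"
    and "\<And>y i j. y \<in> topspace Y \<Longrightarrow> i < n \<Longrightarrow> j < n \<Longrightarrow> p (f y i) = p (f y j)"
  shows "continuous_map Y (fibre_power n E p) f"
  unfolding fibre_power_def continuous_map_in_subtopology
proof
  show "continuous_map Y (product_topology (\<lambda>_. E) {..<n}) f"
    by (rule continuous_map_coordinatewise_then_product) (simp_all add: assms)
qed (intro Pi_I CollectI allI impI assms(3))

lemma continuous_map_configuration_space_projection:
  "i < k \<Longrightarrow> continuous_map (configuration_space X k) X (\<lambda>x. x i)"
  unfolding configuration_space_def
  by (intro continuous_map_from_subtopology continuous_map_product_projection) simp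

lemma continuous_map_fibre_power_projection:
  "i < n \<Longrightarrow> continuous_map (fibre_power n E p) E (\<lambda>e. e i)"
  unfolding fibre_power_def
  by (intro continuous_map_from_subtopology continuous_map_product_projection) simp

section \<open>The plane as the complex numbers\<close>

definition plane_of_complex :: "complex \<Rightarrow> real ^ 2" where
  "plane_of_complex c = (\<chi> i. if i = 1 then Re c else Im c)"

definition complex_of_plane :: "real ^ 2 \<Rightarrow> complex" where
  "complex_of_plane v = Complex (v $ 1) (v $ 2)"

lemma complex_of_plane_of_complex [simp]: "complex_of_plane (plane_of_complex c) = c"
  by (simp add: complex_of_plane_def plane_of_complex_def)

lemma plane_of_complex_inject: "plane_of_complex c = plane_of_complex d \<longleftrightarrow> c = d"
  by (metis complex_of_plane_of_complex)

lemma complex_of_plane_inject: "complex_of_plane v = complex_of_plane w \<longleftrightarrow> v = w"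
  by (auto simp: complex_of_plane_def vec_eq_iff forall_2)

lemma continuous_on_plane_of_complex [continuous_intros]:
  assumes "continuous_on S f"
  shows "continuous_on S (\<lambda>x. plane_of_complex (f x))"
proof -
  have "continuous_on S (\<lambda>x. if i = 1 then Re (f x) else Im (f x))" for i :: 2
    using assms by (cases "i = 1") (auto intro!: continuous_intros)
  then show ?thesis
    unfolding plane_of_complex_def by (rule continuous_on_vec_lambda)
qed

lemma continuous_on_complex_of_plane [continuous_intros]:
  "continuous_on S f \<Longrightarrow> continuous_on S (\<lambda>x. complex_of_plane (f x))"
  unfolding complex_of_plane_def Complex_eq by (intro continuous_intros)

subsection \<open>The lower bound\<close>

text \<open>The paths given by a section join configurations \<open>j'\<close> and \<open>j\<close>
  without collisions, so \<open>log_along_path\<close> turns the data of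
  \<open>torus_config_winding\<close> into continuous branches of the angles, against
  \<open>torus_no_cover\<close>.\<close>

lemma no_small_cover_with_local_sections:
  fixes s t n r :: nat
  defines "E \<equiv> configuration_space (euclidean :: (real ^ 2) topology) (s + t)"
  defines "Y \<equiv> fibre_power n E (fadell_neuwirth s)"
  assumes st: "2 \<le> s" "1 \<le> t" "2 \<le> n" and "r < n * t + s - 2"
    and op: "\<And>i. i \<le> r \<Longrightarrow> openin Y (U i)"
    and sec: "\<And>i. i \<le> r \<Longrightarrow>
          has_local_section (fibre_path_space E (fadell_neuwirth s)) Y (path_evaluation n) (U i)"
    and cover: "(\<Union>i\<le>r. U i) = topspace Y"
  shows False
proof -
  define m where "m = n * t + s - 2"
  define \<tau> where "\<tau> z = (\<lambda>j\<in>{..<n}. \<lambda>i\<in>{..<s + t}. plane_of_complex (torus_config s t n z j i))"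
    for z
  have \<tau>: "continuous_map (top_of_set (torus m)) Y \<tau>"
    unfolding Y_def
  proof (rule continuous_map_into_fibre_power)
    fix j assume "j < n"
    show "continuous_map (top_of_set (torus m)) E (\<lambda>z. \<tau> z j)"
      unfolding E_def
    proof (rule continuous_map_into_configuration_space)
      fix i assume "i < s + t"
      then show "continuous_map (top_of_set (torus m)) euclidean (\<lambda>z. \<tau> z j i)"
        using \<open>j < n\<close> by (auto simp: \<tau>_def intro!: continuous_intros continuous_on_torus_config)
    next
      fix z i i' assume "z \<in> topspace (top_of_set (torus m))" "i < s + t" "i' < s + t" "i \<noteq> i'"
      then have "torus_config s t n z j i \<noteq> torus_config s t n z j i'"
        using torus_config_neq[of s z n t j i i'] st \<open>j < n\<close> by (simp add: m_def)
      then show "\<tau> z j i \<noteq> \<tau> z j i'"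
        using \<open>j < n\<close> \<open>i < s + t\<close> \<open>i' < s + t\<close>
        by (simp add: \<tau>_def plane_of_complex_inject)
    qed (use \<open>j < n\<close> in \<open>auto simp: \<tau>_def\<close>)
  next
    fix z j j' assume "j < n" "j' < n"
    have "torus_config s t n z j i = torus_config s t n z j' i" if "i < s" for i
      using that by (auto simp: torus_config_def)
    then show "fadell_neuwirth s (\<tau> z j) = fadell_neuwirth s (\<tau> z j')"
      using \<open>j < n\<close> \<open>j' < n\<close> by (auto simp: fadell_neuwirth_def \<tau>_def fun_eq_iff)
  qed (auto simp: \<tau>_def)
  \<comment> \<open>The last set is repeated to obtain exactly \<open>m\<close> sets; since
    \<open>r < m\<close>, every \<open>U i\<close> occurs.\<close>
  define V where "V k = {z \<in> torus m. \<tau> z \<in> U (min k r)}" for k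
  show False
  proof (rule torus_no_cover)
    show "openin (top_of_set (torus m)) (V k)" for k
      using openin_continuous_map_preimage[OF \<tau> op[of "min k r"]] by (simp add: V_def)
    show "torus m \<subseteq> (\<Union>k<m. V k)"
    proof
      fix z assume "z \<in> torus m"
      then have "\<tau> z \<in> topspace Y"
        using continuous_map_funspace[OF \<tau>] by auto
      then obtain k where "k \<le> r" "\<tau> z \<in> U k" using cover by blast
      then have "z \<in> V k" "k < m" using \<open>z \<in> torus m\<close> \<open>r < n * t + s - 2\<close> by (auto simp: V_def m_def)
      then show "z \<in> (\<Union>k<m. V k)" by blast
    qed
    fix k K assume "k < m" "compact K" and KV: "K \<subseteq> V k"
    let ?U = "U (min k r)"
    obtain \<sigma> where \<sigma>: "continuous_map (subtopology Y ?U) (fibre_path_space E (fadell_neuwirth s)) \<sigma>"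
      and ev: "\<And>y. y \<in> topspace Y \<inter> ?U \<Longrightarrow> path_evaluation n (\<sigma> y) = y"
      using sec[of "min k r"] unfolding has_local_section_def by auto
    have KT: "K \<subseteq> torus m" using KV by (auto simp: V_def)
    have "continuous_map (top_of_set K) Y \<tau>"
      using continuous_map_from_subtopology_mono[OF \<tau> KT] .
    then have \<tau>K: "continuous_map (top_of_set K) (subtopology Y ?U) \<tau>"
      using KV by (auto simp: continuous_map_in_subtopology V_def)
    have \<tau>Y: "\<tau> z \<in> topspace Y \<inter> ?U" if "z \<in> K" for z
      using continuous_map_funspace[OF \<tau>K] that by auto
    have "continuous_map (top_of_set K) (compact_open_topology (top_of_set {0..1}) E) (\<lambda>z. \<sigma> (\<tau> z))"
      using continuous_map_compose[OF \<tau>K \<sigma>]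
      by (simp add: fibre_path_space_def continuous_map_in_subtopology o_def)
    then have path: "continuous_map (prod_topology (top_of_set K) (top_of_set {0..1})) E (\<lambda>(z, v). \<sigma> (\<tau> z) v)"
      by (rule continuous_map_uncurry_compact_open)
        (auto intro!: compact_imp_locally_compact_space regular_space_subtopology regular_space_euclidean
          simp: compact_space_subtopology)
    obtain j j' a i p q where idx: "j < n" "j' < n" "a < s + t" "i < s + t" "a \<noteq> i"
      and p: "continuous_on (torus m) p" and q: "continuous_on (torus m) q"
      and wind: "\<And>z. z \<in> torus m \<Longrightarrow> torus_config s t n z j a - torus_config s t n z j i = z k * exp (p z)"
      and still: "\<And>z. z \<in> torus m \<Longrightarrow> torus_config s t n z j' a - torus_config s t n z j' i = exp (q z)"
      using torus_config_winding[OF st, of k] \<open>k < m\<close> unfolding m_def by metis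
    \<comment> \<open>The difference of the points \<open>a\<close> and \<open>i\<close> along the
      path; points of a configuration never meet, so it has no zero.\<close>
    define f where "f = (\<lambda>(z, v). complex_of_plane (\<sigma> (\<tau> z) v a) - complex_of_plane (\<sigma> (\<tau> z) v i))"
    have coord: "continuous_on (K \<times> {0..1}) (\<lambda>(z, v). \<sigma> (\<tau> z) v l)" if "l < s + t" for l
    proof -
      have "continuous_map (prod_topology (top_of_set K) (top_of_set {0..1})) euclidean
          (\<lambda>(z, v). \<sigma> (\<tau> z) v l)"
        using continuous_map_compose[OF path[unfolded E_def]
            continuous_map_configuration_space_projection[OF that]]
        by (simp add: o_def case_prod_unfold)
      then show ?thesis
        by (simp add: prod_topology_subtopology_eu)
    qed
    have f: "continuous_on (K \<times> {0..1}) f"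
      unfolding f_def case_prod_unfold
      using coord[OF idx(3)] coord[OF idx(4)] by (auto intro!: continuous_intros simp: case_prod_unfold)
    have fnz: "f (z, v) \<noteq> 0" if "z \<in> K" "v \<in> {0..1}" for z v
    proof -
      have "\<sigma> (\<tau> z) v \<in> topspace E"
        using continuous_map_funspace[OF path] that by (simp add: Pi_iff)
      then have "\<sigma> (\<tau> z) v a \<noteq> \<sigma> (\<tau> z) v i"
        using idx by (auto simp: E_def topspace_configuration_space)
      then show ?thesis by (simp add: f_def complex_of_plane_inject)
    qed
    have f_at: "f (z, real l / real (n - 1)) = torus_config s t n z l a - torus_config s t n z l i"
      if "z \<in> K" "l < n" for z l
    proof -
      have "\<sigma> (\<tau> z) (real l / real (n - 1)) = \<tau> z l"
        using fun_cong[OF ev[OF \<tau>Y[OF that(1)]], of l] that(2) by (simp add: path_evaluation_def)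
      then show ?thesis using idx that by (simp add: f_def \<tau>_def)
    qed
    have time: "real l / real (n - 1) \<in> {0..1}" if "l < n" for l
      using that by (auto simp: divide_simps)
    obtain g where g: "continuous_on K g"
      and fg: "\<And>z. z \<in> K \<Longrightarrow> f (z, real j / real (n - 1)) = f (z, real j' / real (n - 1)) * exp (g z)"
      using log_along_path[OF \<open>compact K\<close> f fnz time[OF idx(2)] time[OF idx(1)]] by blast
    show "\<exists>h. continuous_on K h \<and> (\<forall>z\<in>K. z k = cis (h z))"
    proof (intro exI[of _ "\<lambda>z. Im (q z + g z - p z)"] conjI ballI)
      show "continuous_on K (\<lambda>z. Im (q z + g z - p z))"
        using continuous_on_subset[OF p KT] continuous_on_subset[OF q KT] g
        by (intro continuous_intros)
      fix z assume "z \<in> K"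
      then have "z \<in> torus m" using KT by blast
      have "z k * exp (p z) = exp (q z) * exp (g z)"
        using fg[OF \<open>z \<in> K\<close>] wind still \<open>z \<in> torus m\<close> f_at \<open>z \<in> K\<close> idx by simp
      then have *: "z k = exp (q z + g z - p z)"
        by (simp add: exp_add exp_diff field_simps)
      \<comment> \<open>As \<open>z k\<close> has modulus 1, the real part of its logarithm vanishes
        and the imaginary part is the desired branch.\<close>
      then have "exp (Re (q z + g z - p z)) = 1"
        using norm_torus[OF \<open>z \<in> torus m\<close> \<open>k < m\<close>] by (metis norm_exp_eq_Re)
      then have "Re (q z + g z - p z) = 0" by simp
      then show "z k = cis (Im (q z + g z - p z))"
        using * by (simp add: exp_eq_polar)
    qed
  qed
qed

subsection \<open>Motion planning with a separating direction\<close>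

text \<open>This form lets \<open>tendsto_intros\<close> prove continuity on abstract
  topologies.\<close>

lemma continuous_map_euclidean_iff_tendsto:
  "continuous_map X euclidean f \<longleftrightarrow> (\<forall>x\<in>topspace X. (f \<longlongrightarrow> f x) (atin X x))"
  by (simp add: continuous_map_atin)

lemma tendsto_of_continuous_map:
  "continuous_map X euclidean f \<Longrightarrow> x \<in> topspace X \<Longrightarrow> (f \<longlongrightarrow> f x) (atin X x)"
  by (simp add: continuous_map_euclidean_iff_tendsto)

text \<open>
  The planner moves each point vertically to its own height above all the fixed points, and then
  horizontally onto the imaginary axis. A function that is constantly 1 near an integer time scales
  the horizontal coordinate, so that the two stages do not overlap.
\<close>

definition horizontal_weight :: "real \<Rightarrow> real" where
  "horizontal_weight \<delta> = max 0 (min 1 (2 - 4 * \<bar>\<delta>\<bar>))"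

definition vertical_weight :: "real \<Rightarrow> real" where
  "vertical_weight \<delta> = max 0 (1 - 4 * \<bar>\<delta>\<bar>)"

lemma weights_at_0 [simp]: "horizontal_weight 0 = 1" "vertical_weight 0 = 1"
  by (auto simp: horizontal_weight_def vertical_weight_def)

lemma weights_far: "\<bar>\<delta>\<bar> \<ge> 1 / 2 \<Longrightarrow> horizontal_weight \<delta> = 0 \<and> vertical_weight \<delta> = 0"
  by (auto simp: horizontal_weight_def vertical_weight_def)

text \<open>The switch is at 1/4: up to there the horizontal weight is 1, and from there on the
  vertical weight is 0.\<close>

lemma weights_do_not_overlap: "horizontal_weight \<delta> = 1 \<or> vertical_weight \<delta> = 0"
  by (auto simp: horizontal_weight_def vertical_weight_def)

lemma tendsto_weights [tendsto_intros]:
  assumes "(f \<longlongrightarrow> l) F"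
  shows "((\<lambda>x. horizontal_weight (f x)) \<longlongrightarrow> horizontal_weight l) F"
    and "((\<lambda>x. vertical_weight (f x)) \<longlongrightarrow> vertical_weight l) F"
  unfolding horizontal_weight_def vertical_weight_def
  using assms by (auto intro!: tendsto_intros)

text \<open>The sum bounds all fixed points, which are read off from configuration 0 because all
  configurations share them; adding \<open>i\<close> separates the moving points from each
  other.\<close>

definition height :: "nat \<Rightarrow> (nat \<Rightarrow> nat \<Rightarrow> complex) \<Rightarrow> nat \<Rightarrow> real" where
  "height s w i = 1 + (\<Sum>l<s. \<bar>Im (w 0 l)\<bar>) + real i"

text \<open>Time runs from 0 to \<open>n - 1\<close> and configuration \<open>j\<close> is visited
  at time \<open>j\<close>. At half-integer times all weights vanish, so point \<open>i\<close>
  waits on the imaginary axis at its height, whatever \<open>j\<close> is. At every time at most one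
  summand is nonzero; writing a sum gives continuity without gluing.\<close>

definition planner :: "nat \<Rightarrow> nat \<Rightarrow> (nat \<Rightarrow> nat \<Rightarrow> complex) \<Rightarrow> real \<Rightarrow> nat \<Rightarrow> complex" where
  "planner s n w v i =
     (if i < s then w 0 i
      else Complex (\<Sum>j<n. horizontal_weight (v - real j) * Re (w j i))
             (height s w i + (\<Sum>j<n. vertical_weight (v - real j) * (Im (w j i) - height s w i))))"

lemma one_active_time:
  fixes v :: real and n :: nat
  assumes "0 < n"
  obtains j where "j < n" and "\<And>j'. j' < n \<Longrightarrow> j' \<noteq> j \<Longrightarrow> \<bar>v - real j'\<bar> \<ge> 1 / 2"
proof (cases "\<exists>j<n. \<bar>v - real j\<bar> < 1 / 2")
  case True
  then obtain j where j: "j < n" "\<bar>v - real j\<bar> < 1 / 2" by blast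
  have "\<bar>v - real j'\<bar> \<ge> 1 / 2" if "j' \<noteq> j" for j'
  proof -
    have "\<bar>real j - real j'\<bar> \<ge> 1" using that by linarith
    then show ?thesis using j(2) by linarith
  qed
  with j(1) show ?thesis using that by blast
next
  case False
  then show ?thesis using that[OF assms] by (meson not_less)
qed

lemma planner_single:
  assumes "j < n" and "\<And>j'. j' < n \<Longrightarrow> j' \<noteq> j \<Longrightarrow> \<bar>v - real j'\<bar> \<ge> 1 / 2" and "\<not> i < s"
  shows "planner s n w v i = Complex (horizontal_weight (v - real j) * Re (w j i))
           (height s w i + vertical_weight (v - real j) * (Im (w j i) - height s w i))"
proof -
  have "(\<Sum>j'<n. horizontal_weight (v - real j') * Re (w j' i)) = horizontal_weight (v - real j) * Re (w j i)"
    using assms weights_far by (subst sum.remove[of _ j]) auto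
  moreover have "(\<Sum>j'<n. vertical_weight (v - real j') * (Im (w j' i) - height s w i))
      = vertical_weight (v - real j) * (Im (w j i) - height s w i)"
    using assms weights_far by (subst sum.remove[of _ j]) auto
  ultimately show ?thesis using assms(3) by (simp add: planner_def)
qed

lemma planner_at_nat:
  assumes "j < n" and "i < s \<Longrightarrow> w j i = w 0 i"
  shows "planner s n w (real j) i = w j i"
proof (cases "i < s")
  case False
  have "\<bar>real j - real j'\<bar> \<ge> 1 / 2" if "j' \<noteq> j" for j' using that by linarith
  then show ?thesis
    using planner_single[of j n "real j" i s w] assms False by simp
qed (use assms in \<open>simp add: planner_def\<close>)

text \<open>Collisions are excluded by the real parts while the horizontal weight is 1, and by the
  heights once the vertical weight is 0. One of the two always applies.\<close>

lemma planner_neq: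
  assumes "0 < n" and "\<And>j i. j < n \<Longrightarrow> i < s \<Longrightarrow> w j i = w 0 i"
    and sep: "\<And>j i i'. j < n \<Longrightarrow> i < k \<Longrightarrow> i' < k \<Longrightarrow> i \<noteq> i' \<Longrightarrow> Re (w j i) \<noteq> Re (w j i')"
    and "i < k" "i' < k" "i \<noteq> i'"
  shows "planner s n w v i \<noteq> planner s n w v i'"
proof -
  obtain j where "j < n" and far: "\<And>j'. j' < n \<Longrightarrow> j' \<noteq> j \<Longrightarrow> \<bar>v - real j'\<bar> \<ge> 1 / 2"
    using one_active_time[OF \<open>0 < n\<close>] by blast
  have P: "planner s n w v l = Complex (horizontal_weight (v - real j) * Re (w j l))
      (height s w l + vertical_weight (v - real j) * (Im (w j l) - height s w l))" if "\<not> l < s" for l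
    using planner_single[OF \<open>j < n\<close> _ that] far by blast
  have low: "planner s n w v l = w j l" if "l < s" for l
    using assms(2)[OF \<open>j < n\<close> that] that by (simp add: planner_def)
  have below: "Im (w j l) < height s w l'" if "l < s" for l l'
  proof -
    have "\<bar>Im (w 0 l)\<bar> \<le> (\<Sum>l<s. \<bar>Im (w 0 l)\<bar>)"
      using that by (intro member_le_sum) auto
    then show ?thesis using assms(2)[OF \<open>j < n\<close> that] by (simp add: height_def)
  qed
  have mixed: "planner s n w v l \<noteq> planner s n w v l'" if "l < k" "l' < k" "l < s" "\<not> l' < s" for l l'
    using weights_do_not_overlap[of "v - real j"]
  proof
    assume "horizontal_weight (v - real j) = 1"
    then have "Re (planner s n w v l') = Re (w j l')" using P[OF that(4)] by simp
    then show ?thesis using low[OF that(3)] sep[OF \<open>j < n\<close> that(1,2)] that by fastforce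
  next
    assume "vertical_weight (v - real j) = 0"
    then have "Im (planner s n w v l') = height s w l'" using P[OF that(4)] by simp
    then show ?thesis using low[OF that(3)] below[OF that(3), of l'] by auto
  qed
  show ?thesis
  proof (cases "i < s"; cases "i' < s")
    assume "i < s" "i' < s"
    then show ?thesis using low sep[OF \<open>j < n\<close> assms(4-6)] by metis
  next
    assume "i < s" "\<not> i' < s"
    then show ?thesis using mixed[of i i'] assms by blast
  next
    assume "\<not> i < s" "i' < s"
    then show ?thesis using mixed[of i' i] assms by metis
  next
    assume i: "\<not> i < s" "\<not> i' < s"
    show ?thesis
      using weights_do_not_overlap[of "v - real j"]
    proof
      assume "horizontal_weight (v - real j) = 1"
      then show ?thesis using P[OF i(1)] P[OF i(2)] sep[OF \<open>j < n\<close> assms(4-6)] by simp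
    next
      assume "vertical_weight (v - real j) = 0"
      then show ?thesis using P[OF i(1)] P[OF i(2)] assms(6) by (simp add: height_def)
    qed
  qed
qed

text \<open>Multiplication by \<open>\<kappa> e\<close> rotates and scales the plane until the real
  parts in each configuration are distinct; the planner works in these coordinates and the result is
  divided by \<open>\<kappa> e\<close> again. The factor is the same for all \<open>j\<close>, so
  the fixed points remain common.\<close>

lemma has_local_section_of_direction:
  fixes s t n :: nat
  defines "E \<equiv> configuration_space (euclidean :: (real ^ 2) topology) (s + t)"
  defines "Y \<equiv> fibre_power n E (fadell_neuwirth s)"
  assumes "2 \<le> n"
    and \<kappa>: "continuous_map (subtopology Y U) euclidean \<kappa>"
    and nz: "\<And>e. e \<in> topspace Y \<Longrightarrow> e \<in> U \<Longrightarrow> \<kappa> e \<noteq> 0"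
    and sep: "\<And>e j i i'. e \<in> topspace Y \<Longrightarrow> e \<in> U \<Longrightarrow> j < n \<Longrightarrow> i < s + t \<Longrightarrow> i' < s + t \<Longrightarrow> i \<noteq> i' \<Longrightarrow>
        Re (\<kappa> e * complex_of_plane (e j i)) \<noteq> Re (\<kappa> e * complex_of_plane (e j i'))"
  shows "has_local_section (fibre_path_space E (fadell_neuwirth s)) Y (path_evaluation n) U"
proof -
  let ?Y = "subtopology Y U" and ?I = "top_of_set {0..1::real}"
  define w where "w e j i = \<kappa> e * complex_of_plane (e j i)" for e :: "nat \<Rightarrow> nat \<Rightarrow> real ^ 2" and j i
  \<comment> \<open>The factor \<open>n - 1\<close> turns the evaluation times of
    \<open>path_evaluation\<close> into the integer times of the planner.\<close>
  define path where "path e v = (\<lambda>i\<in>{..<s + t}.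
      plane_of_complex (planner s n (w e) (v * real (n - 1)) i / \<kappa> e))" for e v
  have base: "w e j i = w e 0 i" if "e \<in> topspace Y" "j < n" "i < s" for e j i
  proof -
    have "\<forall>i<n. \<forall>j<n. fadell_neuwirth s (e i) = fadell_neuwirth s (e j)"
      using that(1) unfolding Y_def topspace_fibre_power by blast
    then have "fadell_neuwirth s (e j) = fadell_neuwirth s (e 0)"
      using that(2) \<open>2 \<le> n\<close> by (metis less_le_trans pos2)
    from fun_cong[OF this, of i] show ?thesis
      using that by (simp add: fadell_neuwirth_def w_def)
  qed
  have path_cont: "continuous_map (prod_topology ?Y ?I) E (\<lambda>(e, v). path e v)"
    unfolding E_def
  proof (rule continuous_map_into_configuration_space)
    fix i assume "i < s + t"
    have "continuous_map (prod_topology ?Y ?I) euclidean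
        (\<lambda>q. plane_of_complex (planner s n (w (fst q)) (snd q * real (n - 1)) i / \<kappa> (fst q)))"
    proof -
      let ?Q = "prod_topology ?Y ?I"
      have pt: "continuous_map ?Q euclidean (\<lambda>q. fst q j l)" if "j < n" "l < s + t" for j l
      proof -
        have "continuous_map Y euclidean (\<lambda>e. e j l)"
          unfolding Y_def E_def
          using continuous_map_compose[OF continuous_map_fibre_power_projection[OF that(1)]
              continuous_map_configuration_space_projection[OF that(2)]] by (simp add: o_def)
        then have "continuous_map ?Y euclidean (\<lambda>e. e j l)"
          by (rule continuous_map_from_subtopology)
        from continuous_map_compose[OF continuous_map_fst this] show ?thesis
          by (simp add: o_def)
      qed
      have "continuous_map ?Q euclidean (\<lambda>q. complex_of_plane (fst q j l))" if "j < n" "l < s + t" for j l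
        using continuous_map_compose[OF pt[OF that], of euclidean complex_of_plane]
        by (simp add: o_def continuous_on_complex_of_plane)
      note pt' = tendsto_of_continuous_map[OF this]
      have "continuous_map ?Q euclidean (\<lambda>q. \<kappa> (fst q))"
        using continuous_map_compose[OF continuous_map_fst \<kappa>] by (simp add: o_def)
      note \<kappa>' = tendsto_of_continuous_map[OF this]
      have "continuous_map ?Q euclidean (\<lambda>q. snd q)"
        using continuous_map_snd[of ?Y ?I] by (simp add: continuous_map_in_subtopology)
      note v' = tendsto_of_continuous_map[OF this]
      have w': "((\<lambda>q. w (fst q) j l) \<longlongrightarrow> w (fst q0) j l) (atin ?Q q0)"
        if "q0 \<in> topspace ?Q" "j < n" "l < s + t" for q0 j l
        unfolding w_def using that by (intro tendsto_intros \<kappa>' pt')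
      have h': "((\<lambda>q. height s (w (fst q)) l) \<longlongrightarrow> height s (w (fst q0)) l) (atin ?Q q0)"
        if "q0 \<in> topspace ?Q" for q0 l
        unfolding height_def using that \<open>2 \<le> n\<close> by (intro tendsto_intros w') auto
      have "continuous_map ?Q euclidean (\<lambda>q. planner s n (w (fst q)) (snd q * real (n - 1)) i / \<kappa> (fst q))"
        unfolding continuous_map_euclidean_iff_tendsto
      proof
        fix q0 assume q0: "q0 \<in> topspace ?Q"
        have "((\<lambda>q. planner s n (w (fst q)) (snd q * real (n - 1)) i)
            \<longlongrightarrow> planner s n (w (fst q0)) (snd q0 * real (n - 1)) i) (atin ?Q q0)"
        proof (cases "i < s")
          case True
          then show ?thesis
            unfolding planner_def using w'[OF q0, of 0 i] \<open>2 \<le> n\<close> by simp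
        next
          case False
          then show ?thesis
            unfolding planner_def using q0 \<open>i < s + t\<close>
            by (auto intro!: tendsto_intros w' h' v')
        qed
        then show "((\<lambda>q. planner s n (w (fst q)) (snd q * real (n - 1)) i / \<kappa> (fst q))
            \<longlongrightarrow> planner s n (w (fst q0)) (snd q0 * real (n - 1)) i / \<kappa> (fst q0)) (atin ?Q q0)"
          using q0 nz by (intro tendsto_divide \<kappa>') auto
      qed
      from continuous_map_compose[OF this, of euclidean plane_of_complex] show ?thesis
        by (simp add: o_def continuous_on_plane_of_complex)
    qed
    then show "continuous_map (prod_topology ?Y ?I) euclidean (\<lambda>q. (case q of (e, v) \<Rightarrow> path e v) i)"
      using \<open>i < s + t\<close> by (simp add: path_def case_prod_unfold)
  next
    fix q i i' assume q: "q \<in> topspace (prod_topology ?Y ?I)" and i: "i < s + t" "i' < s + t" "i \<noteq> i'"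
    obtain e v where ev: "q = (e, v)" "e \<in> topspace Y" "e \<in> U" using q by auto
    have "planner s n (w e) (v * real (n - 1)) i \<noteq> planner s n (w e) (v * real (n - 1)) i'"
      by (rule planner_neq[where k = "s + t"]) (use \<open>2 \<le> n\<close> base[OF ev(2)] sep[OF ev(2,3)] i in \<open>auto simp: w_def\<close>)
    then have "planner s n (w e) (v * real (n - 1)) i / \<kappa> e \<noteq> planner s n (w e) (v * real (n - 1)) i' / \<kappa> e"
      using nz[OF ev(2,3)] by simp
    then show "(case q of (e, v) \<Rightarrow> path e v) i \<noteq> (case q of (e, v) \<Rightarrow> path e v) i'"
      using i by (simp add: ev(1) path_def plane_of_complex_inject)
  qed (auto simp: path_def)
  define \<sigma> where "\<sigma> = (\<lambda>e. restrict (path e) {0..1})"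
  have "continuous_map ?Y (fibre_path_space E (fadell_neuwirth s)) \<sigma>"
    unfolding fibre_path_space_def continuous_map_in_subtopology
  proof
    show "continuous_map ?Y (compact_open_topology ?I E) \<sigma>"
      using continuous_map_curry_compact_open[OF path_cont] by (simp add: \<sigma>_def)
    \<comment> \<open>The planner leaves the first \<open>s\<close> points at rest, so the paths
      stay in one fibre.\<close>
    have "fadell_neuwirth s (\<sigma> e u) = fadell_neuwirth s (\<sigma> e v)" if "u \<in> {0..1}" "v \<in> {0..1}" for e u v
      using that by (auto simp: \<sigma>_def path_def fadell_neuwirth_def planner_def)
    then show "\<sigma> \<in> topspace ?Y \<rightarrow> {\<gamma>. \<forall>u\<in>{0..1}. \<forall>v\<in>{0..1}. fadell_neuwirth s (\<gamma> u) = fadell_neuwirth s (\<gamma> v)}"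
      by blast
  qed
  moreover have "path_evaluation n (\<sigma> e) = e" if e: "e \<in> topspace Y \<inter> U" for e
  proof
    fix j
    show "path_evaluation n (\<sigma> e) j = e j"
    proof (cases "j < n")
      case True
      have "e j \<in> topspace E"
        using e True by (auto simp: Y_def topspace_fibre_power)
      then have ext: "e j \<in> extensional {..<s + t}"
        by (auto simp: E_def topspace_configuration_space PiE_def)
      have "real j / real (n - 1) \<in> {0..1}"
        using True \<open>2 \<le> n\<close> by (auto simp: divide_simps)
      then have "path_evaluation n (\<sigma> e) j = path e (real j / real (n - 1))"
        using True by (simp add: path_evaluation_def \<sigma>_def)
      also have "\<dots> = e j"
      proof
        fix i
        show "path e (real j / real (n - 1)) i = e j i"
        proof (cases "i < s + t")
          case i: True
          have "planner s n (w e) (real j) i = w e j i"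
            using base[of e j i] e True by (intro planner_at_nat) auto
          moreover have "real j / real (n - 1) * real (n - 1) = real j"
            using \<open>2 \<le> n\<close> by simp
          ultimately have "path e (real j / real (n - 1)) i = plane_of_complex (complex_of_plane (e j i))"
            using i e nz by (simp add: path_def w_def)
          then show ?thesis
            by (metis complex_of_plane_of_complex complex_of_plane_inject)
        qed (use ext in \<open>simp add: path_def extensional_def\<close>)
      qed
      finally show ?thesis .
    qed (use e in \<open>auto simp: path_evaluation_def Y_def topspace_fibre_power PiE_def extensional_def\<close>)
  qed
  ultimately show ?thesis
    unfolding has_local_section_def by blast
qed

subsection \<open>Packing radii and the upper bound\<close>

text \<open>The separation of the values of \<open>a\<close> on \<open>T\<close>, a minimum over
  pairs and hence meaningful from two points on.\<close>

definition spread :: "('p \<Rightarrow> real) \<Rightarrow> 'p set \<Rightarrow> real" where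
  "spread a T = (MIN p\<in>{p \<in> T \<times> T. fst p \<noteq> snd p}. \<bar>a (fst p) - a (snd p)\<bar>)"

text \<open>For \<open>k\<close> from 2 to \<open>card A\<close>, this is positive exactly when
  \<open>a\<close> takes at least \<open>k\<close> values on \<open>A\<close>. It thus turns the
  number of values, which jumps, into quantities depending continuously on \<open>a\<close>.\<close>

definition packing :: "'p set \<Rightarrow> nat \<Rightarrow> ('p \<Rightarrow> real) \<Rightarrow> real" where
  "packing A k a = (MAX T\<in>{T. T \<subseteq> A \<and> card T = k}. spread a T)"

lemma finite_distinct_pairs: "finite T \<Longrightarrow> finite {p \<in> T \<times> T. fst p \<noteq> snd p}"
  by (rule finite_subset[of _ "T \<times> T"]) auto

lemma distinct_pairs_nonempty:
  assumes "2 \<le> card T"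
  shows "{p \<in> T \<times> T. fst p \<noteq> snd p} \<noteq> {}"
proof -
  obtain x y where "x \<in> T" "y \<in> T" "x \<noteq> y"
    using assms by (metis card_2_iff' obtain_subset_with_card_n subsetD)
  then have "(x, y) \<in> {p \<in> T \<times> T. fst p \<noteq> snd p}" by simp
  then show ?thesis by blast
qed

lemma spread_le: "finite T \<Longrightarrow> p \<in> T \<Longrightarrow> q \<in> T \<Longrightarrow> p \<noteq> q \<Longrightarrow> spread a T \<le> \<bar>a p - a q\<bar>"
  unfolding spread_def
  by (rule Min_le) (auto intro!: finite_imageI finite_distinct_pairs image_eqI[of _ _ "(p, q)"])

lemma spread_attained:
  assumes "finite T" "2 \<le> card T"
  obtains p q where "p \<in> T" "q \<in> T" "p \<noteq> q" "spread a T = \<bar>a p - a q\<bar>"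
proof -
  have "spread a T \<in> (\<lambda>p. \<bar>a (fst p) - a (snd p)\<bar>) ` {p \<in> T \<times> T. fst p \<noteq> snd p}"
    unfolding spread_def
    by (rule Min_in) (use finite_distinct_pairs[OF assms(1)] distinct_pairs_nonempty[OF assms(2)] in auto)
  then show ?thesis using that by auto
qed

lemma finite_card_subsets: "finite A \<Longrightarrow> finite {T. T \<subseteq> A \<and> card T = k}"
  by (rule finite_subset[of _ "Pow A"]) auto

lemma card_subsets_nonempty: "k \<le> card A \<Longrightarrow> {T. T \<subseteq> A \<and> card T = k} \<noteq> {}"
  by (metis (mono_tags, lifting) empty_Collect_eq obtain_subset_with_card_n)

lemma spread_le_packing:
  "finite A \<Longrightarrow> T \<subseteq> A \<Longrightarrow> card T = k \<Longrightarrow> spread a T \<le> packing A k a"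
  unfolding packing_def by (rule Max_ge) (auto simp: finite_card_subsets)

lemma packing_attained:
  assumes "finite A" "k \<le> card A"
  obtains T where "T \<subseteq> A" "card T = k" "packing A k a = spread a T"
proof -
  have "packing A k a \<in> spread a ` {T. T \<subseteq> A \<and> card T = k}"
    unfolding packing_def
    by (rule Max_in) (use finite_card_subsets[OF assms(1)] card_subsets_nonempty[OF assms(2)] in auto)
  then show ?thesis using that by auto
qed

lemma packing_nonneg:
  assumes "finite A" "2 \<le> k" "k \<le> card A"
  shows "0 \<le> packing A k a"
proof -
  obtain T where T: "T \<subseteq> A" "card T = k" "packing A k a = spread a T"
    using packing_attained assms(1,3) .
  obtain p q where "spread a T = \<bar>a p - a q\<bar>"
    using spread_attained[of T a] T assms(2) finite_subset[OF T(1) assms(1)] by metis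
  then show ?thesis using T(3) by simp
qed

lemma packing_pos:
  assumes "finite A" "2 \<le> k" "k \<le> card (a ` A)"
  shows "0 < packing A k a"
proof -
  obtain B where B: "B \<subseteq> a ` A" "card B = k"
    using obtain_subset_with_card_n[OF assms(3)] by blast
  obtain T where T: "T \<subseteq> A" "inj_on a T" "B = a ` T"
    using subset_image_inj[of B a A] B(1) by blast
  have "card T = k" using T B by (simp add: card_image)
  obtain p q where "p \<in> T" "q \<in> T" "p \<noteq> q" "spread a T = \<bar>a p - a q\<bar>"
    using spread_attained[of T a] \<open>card T = k\<close> assms(2) finite_subset[OF T(1) assms(1)] by metis
  then have "0 < spread a T"
    using T(2) by (auto simp: inj_on_def)
  also have "\<dots> \<le> packing A k a"
    using spread_le_packing[OF assms(1) T(1) \<open>card T = k\<close>] .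
  finally show ?thesis .
qed

lemma packing_eq_0:
  assumes "finite A" "2 \<le> k" "k \<le> card A" "card (a ` A) < k"
  shows "packing A k a = 0"
proof -
  obtain T where T: "T \<subseteq> A" "card T = k" "packing A k a = spread a T"
    using packing_attained assms(1,3) .
  have fin: "finite T" using finite_subset[OF T(1) assms(1)] .
  have "card (a ` T) \<le> card (a ` A)"
    using T(1) assms(1) by (intro card_mono) auto
  then have "\<not> inj_on a T"
    using T(2) assms(4) by (auto simp: card_image)
  then obtain p q where "p \<in> T" "q \<in> T" "p \<noteq> q" "a p = a q"
    by (auto simp: inj_on_def)
  then have "spread a T \<le> 0"
    using spread_le[OF fin, of p q a] by simp
  then show ?thesis
    using packing_nonneg[OF assms(1-3), of a] T(3) by simp
qed

text \<open>The values of \<open>a\<close> form \<open>k\<close> clusters around those on an optimal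
  \<open>k\<close>-subset \<open>T\<close>, each value within \<open>packing A (Suc k) a\<close> of
  one of them. The alternatives are that \<open>p\<close> and \<open>q\<close> belong to the same
  cluster or to different ones.\<close>

lemma packing_dichotomy:
  assumes A: "finite A" "2 \<le> k" "Suc k \<le> card A" and "p \<in> A" "q \<in> A"
    and less: "packing A (Suc k) a < packing A k a"
  shows "\<bar>a p - a q\<bar> \<le> 2 * packing A (Suc k) a \<or>
         packing A k a - 2 * packing A (Suc k) a \<le> \<bar>a p - a q\<bar>"
proof -
  let ?\<eta> = "packing A (Suc k) a"
  have "k \<le> card A" using A(3) by simp
  then obtain T where T: "T \<subseteq> A" "card T = k" "packing A k a = spread a T"
    using packing_attained[OF A(1)] by metis
  have fin: "finite T" using finite_subset[OF T(1) A(1)] .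
  have near: "\<exists>r\<in>T. \<bar>a x - a r\<bar> \<le> ?\<eta>" if "x \<in> A" for x
  proof (cases "x \<in> T")
    case True
    then show ?thesis using packing_nonneg[OF A(1) _ A(3), of a] A(2) by (intro bexI[of _ x]) auto
  next
    case False
    then have card: "card (insert x T) = Suc k" using fin T(2) by simp
    then obtain y z where yz: "y \<in> insert x T" "z \<in> insert x T" "y \<noteq> z" "spread a (insert x T) = \<bar>a y - a z\<bar>"
      using spread_attained[of "insert x T" a] fin A(2) by auto
    have "\<bar>a y - a z\<bar> \<le> ?\<eta>"
      using spread_le_packing[OF A(1) _ card, of a] T(1) \<open>x \<in> A\<close> yz(4) by simp
    \<comment> \<open>Gaps inside \<open>T\<close> are at least \<open>packing A k a\<close>, so a
      closer pair in \<open>insert x T\<close> must involve the new point.\<close>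
    moreover have "\<not> (y \<in> T \<and> z \<in> T)"
      using spread_le[OF fin, of y z a] yz(3) less T(3) calculation by auto
    ultimately show ?thesis
      using yz(1-3) by (auto simp: abs_minus_commute)
  qed
  obtain r r' where r: "r \<in> T" "\<bar>a p - a r\<bar> \<le> ?\<eta>" and r': "r' \<in> T" "\<bar>a q - a r'\<bar> \<le> ?\<eta>"
    using near[OF \<open>p \<in> A\<close>] near[OF \<open>q \<in> A\<close>] by blast
  show ?thesis
  proof (cases "r = r'")
    case True
    then show ?thesis using r(2) r'(2) by simp linarith
  next
    case False
    then have "packing A k a \<le> \<bar>a r - a r'\<bar>"
      using spread_le[OF fin r(1) r'(1)] T(3) by simp
    then show ?thesis using r r' by linarith
  qed
qed

lemma tendsto_Max_Min:
  fixes f :: "'x \<Rightarrow> 'i \<Rightarrow> real"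
  assumes "finite S" "S \<noteq> {}" and "\<And>i. i \<in> S \<Longrightarrow> ((\<lambda>x. f x i) \<longlongrightarrow> l i) F"
  shows "((\<lambda>x. MAX i\<in>S. f x i) \<longlongrightarrow> (MAX i\<in>S. l i)) F"
    and "((\<lambda>x. MIN i\<in>S. f x i) \<longlongrightarrow> (MIN i\<in>S. l i)) F"
  using assms by (induction S rule: finite_ne_induct) (auto intro!: tendsto_max tendsto_min)

lemma tendsto_packing:
  assumes A: "finite A" "2 \<le> k" "k \<le> card A"
    and lim: "\<And>p. p \<in> A \<Longrightarrow> ((\<lambda>x. a x p) \<longlongrightarrow> l p) F"
  shows "((\<lambda>x. packing A k (a x)) \<longlongrightarrow> packing A k l) F"
  unfolding packing_def
proof (rule tendsto_Max_Min(1)[OF finite_card_subsets[OF A(1)] card_subsets_nonempty[OF A(3)]])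
  fix T assume "T \<in> {T. T \<subseteq> A \<and> card T = k}"
  then have T: "T \<subseteq> A" "finite T" "2 \<le> card T"
    using finite_subset[OF _ A(1)] A(2) by auto
  show "((\<lambda>x. spread (a x) T) \<longlongrightarrow> spread l T) F"
    unfolding spread_def
    using T by (intro tendsto_Max_Min(2) finite_distinct_pairs distinct_pairs_nonempty tendsto_intros lim) auto
qed

text \<open>If the tilted real part vanished, \<open>Re \<Delta>\<close> would be at most
  \<open>g / 4\<close> in absolute value, which excludes the far alternative. In the near one,
  \<open>Im \<Delta>\<close> carries almost all of the modulus, and by \<open>near\<close> the tilt
  moves the point by more than \<open>2 * \<eta>\<close>.\<close>

lemma tilted_Re_neq_0:
  fixes \<Delta> :: complex
  assumes "\<bar>Re \<Delta>\<bar> \<le> 2 * \<eta> \<or> g - 2 * \<eta> \<le> \<bar>Re \<Delta>\<bar>" "0 \<le> \<eta>" "4 * \<eta> < g"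
    and "\<bar>Im \<Delta>\<bar> \<le> I" "0 < I"
    and near: "2 * \<eta> < g / (4 * I) * (cmod \<Delta> - 2 * \<eta>)"
  shows "Re \<Delta> + g / (4 * I) * Im \<Delta> \<noteq> 0"
proof
  let ?\<epsilon> = "g / (4 * I)"
  assume "Re \<Delta> + ?\<epsilon> * Im \<Delta> = 0"
  then have "Re \<Delta> = - (?\<epsilon> * Im \<Delta>)" by linarith
  moreover have "?\<epsilon> > 0" using assms by simp
  ultimately have eq: "\<bar>Re \<Delta>\<bar> = ?\<epsilon> * \<bar>Im \<Delta>\<bar>"
    by (metis abs_minus_cancel abs_mult abs_of_pos)
  have "?\<epsilon> * \<bar>Im \<Delta>\<bar> \<le> ?\<epsilon> * I" using assms \<open>?\<epsilon> > 0\<close> by (intro mult_left_mono) auto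
  also have "\<dots> = g / 4" using \<open>0 < I\<close> by simp
  finally have "\<bar>Re \<Delta>\<bar> \<le> g / 4" using eq by simp
  then have le: "\<bar>Re \<Delta>\<bar> \<le> 2 * \<eta>" using assms(1-3) by linarith
  then have "cmod \<Delta> - 2 * \<eta> \<le> \<bar>Im \<Delta>\<bar>"
    using cmod_le[of \<Delta>] by linarith
  then have "?\<epsilon> * (cmod \<Delta> - 2 * \<eta>) \<le> ?\<epsilon> * \<bar>Im \<Delta>\<bar>"
    using \<open>?\<epsilon> > 0\<close> by (intro mult_left_mono) auto
  then show False using near eq le by linarith
qed

section \<open>The open cover indexed by the number of real parts\<close>

lemma openin_less:
  fixes f g :: "'x \<Rightarrow> real"
  assumes "continuous_map X euclidean f" "continuous_map X euclidean g"
  shows "openin X {x \<in> topspace X. f x < g x}"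
proof -
  have "continuous_map X euclidean (\<lambda>x. g x - f x)"
    using assms by (intro continuous_map_diff)
  from openin_continuous_map_preimage[OF this, of "{0<..}"] show ?thesis by simp
qed

lemma openin_finite_Ball:
  assumes "finite S" "\<And>s. s \<in> S \<Longrightarrow> openin X {x \<in> topspace X. P s x}"
  shows "openin X {x \<in> topspace X. \<forall>s\<in>S. P s x}"
  using assms
proof (induction S rule: finite_induct)
  case (insert s S)
  have "{x \<in> topspace X. \<forall>s\<in>insert s S. P s x}
      = {x \<in> topspace X. P s x} \<inter> {x \<in> topspace X. \<forall>s\<in>S. P s x}" by blast
  then show ?case using insert by (simp add: openin_Int)
qed simp

text \<open>There is one open set for each possible number \<open>k\<close> of real parts, from 2 to
  \<open>n * t + s\<close>, that is \<open>n * t + s - 1\<close> sets.\<close>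

lemma cover_with_local_sections:
  fixes s t n :: nat
  defines "E \<equiv> configuration_space (euclidean :: (real ^ 2) topology) (s + t)"
  defines "Y \<equiv> fibre_power n E (fadell_neuwirth s)"
  assumes st: "2 \<le> s" "1 \<le> t" "2 \<le> n"
  shows "\<exists>U. (\<forall>i\<le>n * t + s - 2. openin Y (U i) \<and>
      has_local_section (fibre_path_space E (fadell_neuwirth s)) Y (path_evaluation n) (U i)) \<and>
      (\<Union>i\<le>n * t + s - 2. U i) = topspace Y"
proof -
  define A where "A = {..<n} \<times> {..<s + t}"
  \<comment> \<open>Dividing by \<open>d\<close> places the first two fixed points at 0 and 1, which
    guarantees at least two real parts.\<close>
  define d where "d e = complex_of_plane (e 0 1) - complex_of_plane (e 0 0)" for e :: "nat \<Rightarrow> nat \<Rightarrow> real ^ 2"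
  define \<omega> where "\<omega> e p = (complex_of_plane (e (fst p) (snd p)) - complex_of_plane (e 0 0)) / d e"
    for e :: "nat \<Rightarrow> nat \<Rightarrow> real ^ 2" and p
  define a where "a e p = Re (\<omega> e p)" for e p
  define \<eta> where "\<eta> k e = packing A k (a e)" for k e
  \<comment> \<open>A bound for the imaginary part of every difference; the summand 1 keeps it
    positive, so that it can be divided by.\<close>
  define I where "I e = 1 + 2 * (\<Sum>p\<in>A. \<bar>Im (\<omega> e p)\<bar>)" for e
  define \<epsilon> where "\<epsilon> k e = \<eta> k e / (4 * I e)" for k e
  define C where "C = {(j, i, i'). j < n \<and> i < s + t \<and> i' < s + t \<and> i \<noteq> i'}"
  \<comment> \<open>The first condition separates the clusters, the second is the hypothesis
    \<open>near\<close> of \<open>tilted_Re_neq_0\<close> for all pairs within one configuration.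
    When there are exactly \<open>k\<close> real parts, \<open>\<eta> (Suc k) e\<close> is 0 and
    both hold.\<close>
  define U where "U k = {e \<in> topspace Y. 4 * \<eta> (Suc k) e < \<eta> k e} \<inter>
     {e \<in> topspace Y. \<forall>(j, i, i')\<in>C. 2 * \<eta> (Suc k) e < \<epsilon> k e * (cmod (\<omega> e (j, i) - \<omega> e (j, i')) - 2 * \<eta> (Suc k) e)}"
    for k
  \<comment> \<open>The real part of \<open>1 - \<i> * \<epsilon>\<close> times a difference is its
    real part plus \<epsilon> times its imaginary part, the tilted real part.\<close>
  define \<kappa> where "\<kappa> k e = (1 - \<i> * of_real (\<epsilon> k e)) / d e" for k e
  have "finite A" by (simp add: A_def)
  have "finite C"
    by (rule finite_subset[of _ "{..<n} \<times> {..<s + t} \<times> {..<s + t}"]) (auto simp: C_def)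
  \<comment> \<open>The index set counts the fixed points once for each configuration. It is
    therefore large enough for \<open>packing\<close> at \<open>Suc k\<close> even when
    \<open>k\<close> is the greatest possible number of real parts.\<close>
  have "n * t + s + 1 \<le> n * t + n * s"
    using st mult_le_mono1[of 2 n s] by linarith
  then have card_A: "n * t + s + 1 \<le> card A"
    by (simp add: A_def distrib_left)
  have neq: "complex_of_plane (e j i) \<noteq> complex_of_plane (e j i')"
    if "e \<in> topspace Y" "j < n" "i < s + t" "i' < s + t" "i \<noteq> i'" for e j i i'
    using that unfolding Y_def E_def topspace_fibre_power
    by (auto simp: PiE_iff topspace_configuration_space complex_of_plane_inject)
  have d_nz: "d e \<noteq> 0" if "e \<in> topspace Y" for e
    using neq[OF that, of 0 1 0] st by (simp add: d_def)
  have I_pos: "0 < I e" for e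
    unfolding I_def by (intro add_pos_nonneg mult_nonneg_nonneg sum_nonneg) auto
  have \<omega>_neq: "\<omega> e (j, i) \<noteq> \<omega> e (j, i')"
    if "e \<in> topspace Y" "j < n" "i < s + t" "i' < s + t" "i \<noteq> i'" for e j i i'
    using neq[OF that] d_nz[OF that(1)] by (simp add: \<omega>_def)
  have pt: "((\<lambda>e. complex_of_plane (e j i)) \<longlongrightarrow> complex_of_plane (e0 j i)) (atin Y e0)"
    if "e0 \<in> topspace Y" "j < n" "i < s + t" for j i e0
  proof -
    have "continuous_map Y euclidean (\<lambda>e. e j i)"
      unfolding Y_def E_def
      using continuous_map_compose[OF continuous_map_fibre_power_projection[OF that(2)]
          continuous_map_configuration_space_projection[OF that(3)]] by (simp add: o_def)
    from continuous_map_compose[OF this, of euclidean complex_of_plane]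
    have "continuous_map Y euclidean (\<lambda>e. complex_of_plane (e j i))"
      by (simp add: o_def continuous_on_complex_of_plane)
    then show ?thesis
      using that(1) by (rule tendsto_of_continuous_map)
  qed
  have d_lim: "(d \<longlongrightarrow> d e0) (atin Y e0)" if "e0 \<in> topspace Y" for e0
    unfolding d_def using st by (intro tendsto_intros pt that) auto
  have \<omega>_lim: "((\<lambda>e. \<omega> e p) \<longlongrightarrow> \<omega> e0 p) (atin Y e0)" if "e0 \<in> topspace Y" "p \<in> A" for e0 p
    unfolding \<omega>_def using st that by (intro tendsto_intros pt d_lim d_nz) (auto simp: A_def)
  have \<eta>_lim: "(\<eta> k \<longlongrightarrow> \<eta> k e0) (atin Y e0)"
    if "e0 \<in> topspace Y" "2 \<le> k" "k \<le> n * t + s + 1" for e0 k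
    unfolding \<eta>_def a_def using that card_A \<open>finite A\<close>
    by (intro tendsto_packing tendsto_intros \<omega>_lim) auto
  have I_lim: "(I \<longlongrightarrow> I e0) (atin Y e0)" if "e0 \<in> topspace Y" for e0
    unfolding I_def by (intro tendsto_intros \<omega>_lim that)
  have I_nz: "4 * I e \<noteq> 0" for e using I_pos[of e] by simp
  have \<epsilon>_lim: "(\<epsilon> k \<longlongrightarrow> \<epsilon> k e0) (atin Y e0)"
    if "e0 \<in> topspace Y" "2 \<le> k" "k \<le> n * t + s + 1" for e0 k
    unfolding \<epsilon>_def by (intro tendsto_intros I_lim \<eta>_lim that I_nz)
  have open_U: "openin Y (U k)" if k: "2 \<le> k" "k \<le> n * t + s" for k
  proof -
    have k': "2 \<le> Suc k" "Suc k \<le> n * t + s + 1" "k \<le> n * t + s + 1" using k by auto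
    have "openin Y {e \<in> topspace Y. 4 * \<eta> (Suc k) e < \<eta> k e}"
      by (intro openin_less; unfold continuous_map_euclidean_iff_tendsto)
        (auto intro!: tendsto_intros \<eta>_lim k k')
    moreover have "openin Y {e \<in> topspace Y. \<forall>(j, i, i')\<in>C.
        2 * \<eta> (Suc k) e < \<epsilon> k e * (cmod (\<omega> e (j, i) - \<omega> e (j, i')) - 2 * \<eta> (Suc k) e)}"
    proof (rule openin_finite_Ball[OF \<open>finite C\<close>])
      fix c assume "c \<in> C"
      then obtain j i i' where c: "c = (j, i, i')" and mem: "(j, i) \<in> A" "(j, i') \<in> A"
        by (auto simp: C_def A_def)
      have "openin Y {e \<in> topspace Y.
          2 * \<eta> (Suc k) e < \<epsilon> k e * (cmod (\<omega> e (j, i) - \<omega> e (j, i')) - 2 * \<eta> (Suc k) e)}"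
        by (intro openin_less; unfold continuous_map_euclidean_iff_tendsto)
          (auto intro!: tendsto_intros \<eta>_lim \<epsilon>_lim \<omega>_lim mem k k')
      then show "openin Y {e \<in> topspace Y. case c of (j, i, i') \<Rightarrow>
          2 * \<eta> (Suc k) e < \<epsilon> k e * (cmod (\<omega> e (j, i) - \<omega> e (j, i')) - 2 * \<eta> (Suc k) e)}"
        by (simp add: c)
    qed
    ultimately show ?thesis unfolding U_def by (rule openin_Int)
  qed
  have section_U: "has_local_section (fibre_path_space E (fadell_neuwirth s)) Y (path_evaluation n) (U k)"
    if k: "2 \<le> k" "k \<le> n * t + s" for k
  proof (rule has_local_section_of_direction[where s = s and t = t and n = n and U = "U k" and \<kappa> = "\<kappa> k",
          folded E_def, folded Y_def, OF \<open>2 \<le> n\<close>])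
    have k': "k \<le> n * t + s + 1" using k by simp
    have "continuous_map Y euclidean (\<kappa> k)"
      unfolding \<kappa>_def continuous_map_euclidean_iff_tendsto
      by (intro ballI tendsto_intros \<epsilon>_lim d_lim d_nz k k')
    then show "continuous_map (subtopology Y (U k)) euclidean (\<kappa> k)"
      by (rule continuous_map_from_subtopology)
  next
    fix e assume "e \<in> topspace Y"
    have "Re (1 - \<i> * of_real (\<epsilon> k e)) \<noteq> Re 0" by simp
    then have "1 - \<i> * of_real (\<epsilon> k e) \<noteq> 0" by metis
    then show "\<kappa> k e \<noteq> 0"
      using d_nz[OF \<open>e \<in> topspace Y\<close>] by (simp add: \<kappa>_def)
  next
    fix e j i i' assume e: "e \<in> topspace Y" "e \<in> U k" and ji: "j < n" "i < s + t" "i' < s + t" "i \<noteq> i'"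
    let ?\<Delta> = "\<omega> e (j, i) - \<omega> e (j, i')"
    have mem: "(j, i) \<in> A" "(j, i') \<in> A" using ji by (auto simp: A_def)
    have card: "Suc k \<le> card A" using k card_A by simp
    have pos: "0 \<le> \<eta> (Suc k) e"
      unfolding \<eta>_def using packing_nonneg[OF \<open>finite A\<close> _ card] k by simp
    have lt: "4 * \<eta> (Suc k) e < \<eta> k e" using e by (simp add: U_def)
    have "\<bar>Re ?\<Delta>\<bar> \<le> 2 * \<eta> (Suc k) e \<or> \<eta> k e - 2 * \<eta> (Suc k) e \<le> \<bar>Re ?\<Delta>\<bar>"
      using packing_dichotomy[OF \<open>finite A\<close> k(1) card mem, of "a e"] lt pos by (simp add: \<eta>_def a_def)
    moreover have "\<bar>Im ?\<Delta>\<bar> \<le> I e"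
    proof -
      have "\<bar>Im (\<omega> e p)\<bar> \<le> (\<Sum>p\<in>A. \<bar>Im (\<omega> e p)\<bar>)" if "p \<in> A" for p
        using that \<open>finite A\<close> by (intro member_le_sum) auto
      from this[OF mem(1)] this[OF mem(2)] show ?thesis by (simp add: I_def)
    qed
    moreover have "2 * \<eta> (Suc k) e < \<epsilon> k e * (cmod ?\<Delta> - 2 * \<eta> (Suc k) e)"
      using e(2) ji by (auto simp: U_def C_def)
    ultimately have "Re ?\<Delta> + \<epsilon> k e * Im ?\<Delta> \<noteq> 0"
      unfolding \<epsilon>_def using pos lt I_pos by (intro tilted_Re_neq_0) auto
    moreover have "\<kappa> k e * complex_of_plane (e j i) - \<kappa> k e * complex_of_plane (e j i')
        = (1 - \<i> * of_real (\<epsilon> k e)) * ?\<Delta>"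
      by (simp add: \<kappa>_def \<omega>_def diff_divide_distrib[symmetric] right_diff_distrib[symmetric])
    ultimately have "Re (\<kappa> k e * complex_of_plane (e j i) - \<kappa> k e * complex_of_plane (e j i')) \<noteq> 0"
      by simp
    then show "Re (\<kappa> k e * complex_of_plane (e j i)) \<noteq> Re (\<kappa> k e * complex_of_plane (e j i'))"
      by simp
  qed
  have cover: "\<exists>k. 2 \<le> k \<and> k \<le> n * t + s \<and> e \<in> U k" if e: "e \<in> topspace Y" for e
  proof -
    define k where "k = card (a e ` A)"
    have "a e (0, 0) = 0" "a e (0, 1) = 1"
      using d_nz[OF e] by (simp_all add: a_def \<omega>_def d_def)
    moreover have "(0, 0) \<in> A" "(0, 1) \<in> A" using st by (auto simp: A_def)
    ultimately have "{0, 1} \<subseteq> a e ` A" by (metis empty_subsetI image_eqI insert_subset)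
    from card_mono[OF _ this] have "2 \<le> k" using \<open>finite A\<close> by (simp add: k_def)
    \<comment> \<open>Fixed points agree in all configurations, so those of configuration 0 and all
      moving points already give every value.\<close>
    let ?B = "{0} \<times> {..<s} \<union> {..<n} \<times> {s..<s + t}"
    have "a e ` A \<subseteq> a e ` ?B"
    proof
      fix x assume "x \<in> a e ` A"
      then obtain j i where x: "x = a e (j, i)" and ji: "j < n" "i < s + t" by (auto simp: A_def)
      show "x \<in> a e ` ?B"
      proof (cases "i < s")
        case True
        have "\<forall>i<n. \<forall>j<n. fadell_neuwirth s (e i) = fadell_neuwirth s (e j)"
          using e unfolding Y_def topspace_fibre_power by blast
        then have "fadell_neuwirth s (e j) = fadell_neuwirth s (e 0)"
          using ji \<open>2 \<le> n\<close> by (metis less_le_trans pos2)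
        from fun_cong[OF this, of i] True have "e j i = e 0 i" by (simp add: fadell_neuwirth_def)
        then have "x = a e (0, i)" by (simp add: x a_def \<omega>_def)
        then show ?thesis using True by auto
      qed (use x ji in auto)
    qed
    then have "k \<le> card (a e ` ?B)" unfolding k_def by (intro card_mono) auto
    also have "\<dots> \<le> card ?B" by (intro card_image_le) auto
    also have "\<dots> \<le> s + n * t"
      using card_Un_le[of "{0::nat} \<times> {..<s}" "{..<n} \<times> {s..<s + t}"] by simp
    finally have "k \<le> n * t + s" by simp
    have "0 < \<eta> k e"
      unfolding \<eta>_def using \<open>finite A\<close> \<open>2 \<le> k\<close> by (intro packing_pos) (simp_all add: k_def)
    moreover have "\<eta> (Suc k) e = 0"
      unfolding \<eta>_def using \<open>finite A\<close> \<open>2 \<le> k\<close> \<open>k \<le> n * t + s\<close> card_A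
      by (intro packing_eq_0) (simp_all add: k_def)
    moreover have "0 < \<epsilon> k e"
      unfolding \<epsilon>_def using \<open>0 < \<eta> k e\<close> I_pos[of e] by simp
    moreover have "0 < cmod (\<omega> e (j, i) - \<omega> e (j, i'))" if "(j, i, i') \<in> C" for j i i'
      using \<omega>_neq[OF e] that by (simp add: C_def)
    ultimately have "e \<in> U k"
      using e by (auto simp: U_def)
    with \<open>2 \<le> k\<close> \<open>k \<le> n * t + s\<close> show ?thesis by blast
  qed
  show ?thesis
  \<comment> \<open>The shift by 2 numbers the sets from 0 to \<open>n * t + s - 2\<close>.\<close>
  proof (intro exI[of _ "\<lambda>i. U (i + 2)"] conjI allI impI)
    fix i assume "i \<le> n * t + s - 2"
    then have "2 \<le> i + 2" "i + 2 \<le> n * t + s" using st by auto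
    then show "openin Y (U (i + 2))"
      "has_local_section (fibre_path_space E (fadell_neuwirth s)) Y (path_evaluation n) (U (i + 2))"
      by (rule open_U, rule section_U)
  next
    show "(\<Union>i\<le>n * t + s - 2. U (i + 2)) = topspace Y"
    proof
      show "(\<Union>i\<le>n * t + s - 2. U (i + 2)) \<subseteq> topspace Y" by (auto simp: U_def)
      show "topspace Y \<subseteq> (\<Union>i\<le>n * t + s - 2. U (i + 2))"
      proof
        fix e assume "e \<in> topspace Y"
        then obtain k where "2 \<le> k" "k \<le> n * t + s" "e \<in> U k" using cover by blast
        then obtain l where "k = 2 + l" using le_Suc_ex by blast
        then have "l \<le> n * t + s - 2" "e \<in> U (l + 2)"
          using \<open>k \<le> n * t + s\<close> \<open>e \<in> U k\<close> by (simp_all add: add.commute)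
        then show "e \<in> (\<Union>i\<le>n * t + s - 2. U (i + 2))" by blast
      qed
    qed
  qed
qed

theorem theorem5p2:
  fixes s t n :: nat
  assumes "s \<ge> 2" and "t \<ge> 1" and "n \<ge> 2"
  shows "seq_param_TC n (configuration_space (euclidean :: (real ^ 2) topology) (s + t))
           (fadell_neuwirth s) = enat (n * t + s - 2)"
  unfolding seq_param_TC_def
proof (rule antisym)
  show "Inf {enat r | r. \<exists>U :: nat \<Rightarrow> (nat \<Rightarrow> nat \<Rightarrow> real ^ 2) set.
      (\<forall>i\<le>r. openin (fibre_power n (configuration_space euclidean (s + t)) (fadell_neuwirth s)) (U i) \<and>
         has_local_section (fibre_path_space (configuration_space euclidean (s + t)) (fadell_neuwirth s))
           (fibre_power n (configuration_space euclidean (s + t)) (fadell_neuwirth s)) (path_evaluation n) (U i)) \<and>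
      (\<Union>i\<le>r. U i) = topspace (fibre_power n (configuration_space euclidean (s + t)) (fadell_neuwirth s))}
    \<le> enat (n * t + s - 2)"
    using cover_with_local_sections[OF assms] by (intro Inf_lower) blast
  show "enat (n * t + s - 2) \<le> Inf {enat r | r. \<exists>U :: nat \<Rightarrow> (nat \<Rightarrow> nat \<Rightarrow> real ^ 2) set.
      (\<forall>i\<le>r. openin (fibre_power n (configuration_space euclidean (s + t)) (fadell_neuwirth s)) (U i) \<and>
         has_local_section (fibre_path_space (configuration_space euclidean (s + t)) (fadell_neuwirth s))
           (fibre_power n (configuration_space euclidean (s + t)) (fadell_neuwirth s)) (path_evaluation n) (U i)) \<and>
      (\<Union>i\<le>r. U i) = topspace (fibre_power n (configuration_space euclidean (s + t)) (fadell_neuwirth s))}"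
  proof (rule Inf_greatest, clarify)
    fix r and U :: "nat \<Rightarrow> (nat \<Rightarrow> nat \<Rightarrow> real ^ 2) set"
    let ?E = "configuration_space (euclidean :: (real ^ 2) topology) (s + t)"
    let ?Y = "fibre_power n ?E (fadell_neuwirth s)"
    assume U: "\<forall>i\<le>r. openin ?Y (U i) \<and>
        has_local_section (fibre_path_space ?E (fadell_neuwirth s)) ?Y (path_evaluation n) (U i)"
      and cover: "(\<Union>i\<le>r. U i) = topspace ?Y"
    show "enat (n * t + s - 2) \<le> enat r"
    proof (rule ccontr)
      assume "\<not> enat (n * t + s - 2) \<le> enat r"
      then have "r < n * t + s - 2" by simp
      then show False
        using no_small_cover_with_local_sections[OF assms _ _ _ cover] U by blast
    qed
  qed
qed

end
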